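(* Let $(W,\varepsilon_W)$ be a directed closed walk in a signed graph $\Sigma$ such that (i) $(W,\varepsilon_W)$ is midway-back avoided; (ii) each double vertex in $W$ is a cut-point of $\Sigma(W)$. Then $\Sigma(W)$ is an Eulerian cycle-tree, the restriction of $\varepsilon_W$ to $\Sigma(W)$ is a direction on this cycle-tree, and $W$ uses each edge of the block cycles once and each edge of the block paths twice, crossing from one block to the other block at each cut-point.
   Context: A signed graph $\Sigma=(V,E,\sigma)$ is a finite graph (loops, multiple edges allowed) with $\sigma:E\to\{\pm1\}$. A cycle is a simple closed path (a loop is a cycle); balanced if the product of its edge signs is $+1$, unbalanced otherwise. An orientation of a signed subgraph assigns $\pm1$ to each pair $(v,e)$ with $v$ an end-vertex of $e$, with $\varepsilon(u,e)\varepsilon(v,e)=-\sigma(e)$ for $e=uv$; $+1$ means the arrow points away from $v$. A sink (source) is a vertex all of whose arrows point toward (away from) it. A walk $W=u_0x_1u_1\cdots x_nu_n$ ($x_i$ has ends $u_{i-1},u_i$); $\Sigma(W)$ is the signed subgraph formed by its edges. A direction $\varepsilon_W$ of $W$: values $\pm1$ on the pairs $(u_{i-1},x_i),(u_i,x_i)$ with $\varepsilon_W(u_{i-1},x_i)\varepsilon_W(u_i,x_i)=-\sigma(x_i)$, $\varepsilon_W(u_i,x_i)+\varepsilon_W(u_i,x_{i+1})=0$; directed closed walk: also $u_0=u_n$, $\varepsilon_W(u_0,x_1)+\varepsilon_W(u_n,x_n)=0$. Midway-back avoided: whenever $u_\alpha=u_\beta$ with $0\le\alpha<\beta<n$, $\varepsilon_W(u_\beta,x_\beta)=\varepsilon_W(u_\alpha,x_{\alpha+1})$.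 A double vertex is a vertex occurring twice among $u_0,\dots,u_{n-1}$. A cut-point is a vertex whose removal increases the number of connected components. A cycle-tree is a connected signed subgraph $T$ decomposed into edge-disjoint cycles (block cycles) and vertex-disjoint simple paths (block paths, possibly of length zero) such that: the block cycles are all cycles of $T$; two block cycles share at most one vertex (an intersection vertex); each block path meets exactly two block cycles, exactly at its two end-vertices (also intersection vertices); every intersection vertex is a cut-point of $T$. It is Eulerian if each balanced block cycle has an even number and each unbalanced block cycle an odd number of intersection vertices. A direction of a cycle-tree $T$ is an orientation $\varepsilon_T$ of $T$ such that $(T,\varepsilon_T)$ has neither sink nor source, and for each block cycle $C$, the restriction of $\varepsilon_T$ to $C$ has a sink or a source at each cut-point of $T$ lying on $C$. *)

theory Defs
  imports Main
begin

(* Loops and multiple edges are allowed.  Every edge e has two ends, named by the two booleans;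
   "ends G e b" is the vertex at end b, so a loop has two ends at the same vertex.  Subgraphs are
   records with the same incidence and sign functions and smaller vertex and edge sets. *)

record ('v, 'e) signed_graph =
  verts :: "'v set"
  edges :: "'e set"
  ends  :: "'e \<Rightarrow> bool \<Rightarrow> 'v"
  sign  :: "'e \<Rightarrow> int"

definition wf_signed_graph :: "('v, 'e) signed_graph \<Rightarrow> bool" where
  "wf_signed_graph G \<longleftrightarrow>
     finite (verts G) \<and> finite (edges G) \<and>
     (\<forall>e\<in>edges G. \<forall>b. ends G e b \<in> verts G) \<and>
     (\<forall>e\<in>edges G. sign G e \<in> {1, -1})"

definition subgraph :: "('v, 'e) signed_graph \<Rightarrow> ('v, 'e) signed_graph \<Rightarrow> bool" where
  "subgraph H G \<longleftrightarrow>
     wf_signed_graph H \<and> verts H \<subseteq> verts G \<and> edges H \<subseteq> edges G \<and>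
     ends H = ends G \<and> sign H = sign G"


section \<open>Components, cut-points, blocks\<close>

definition adj :: "('v, 'e) signed_graph \<Rightarrow> ('v \<times> 'v) set" where
  "adj G = {(ends G e b, ends G e (\<not> b)) | e b. e \<in> edges G}"

definition components :: "('v, 'e) signed_graph \<Rightarrow> 'v set set" where
  "components G = verts G // {(u, v). u \<in> verts G \<and> v \<in> verts G \<and> (u, v) \<in> (adj G)\<^sup>*}"

definition connected_graph :: "('v, 'e) signed_graph \<Rightarrow> bool" where
  "connected_graph G \<longleftrightarrow> card (components G) = 1"

definition delete_vertex :: "('v, 'e) signed_graph \<Rightarrow> 'v \<Rightarrow> ('v, 'e) signed_graph" where
  "delete_vertex G v =
     G\<lparr>verts := verts G - {v}, edges := {e \<in> edges G. \<forall>b. ends G e b \<noteq> v}\<rparr>"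

(* Deleting v deletes its incident edges, loops at v included; hence a loop at v does not by
   itself make v a cut-point. *)
definition cut_point :: "('v, 'e) signed_graph \<Rightarrow> 'v \<Rightarrow> bool" where
  "cut_point G v \<longleftrightarrow>
     v \<in> verts G \<and> card (components (delete_vertex G v)) > card (components G)"

definition nonseparable :: "('v, 'e) signed_graph \<Rightarrow> bool" where
  "nonseparable G \<longleftrightarrow> connected_graph G \<and> (\<forall>v. \<not> cut_point G v)"

definition block :: "('v, 'e) signed_graph \<Rightarrow> ('v, 'e) signed_graph \<Rightarrow> bool" where
  "block G B \<longleftrightarrow>
     subgraph B G \<and> nonseparable B \<and>
     (\<forall>D. subgraph D G \<and> nonseparable D \<and> subgraph B D \<longrightarrow> D = B)"


section \<open>Orientations\<close>

(* An orientation is a function of an edge and one of its ends: "eps e b" is the value on the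
   pair (ends G e b, e).  This gives a loop two values, as required for positive loops.
   Restricting an orientation to a subgraph means using the same function there. *)
definition orientation :: "('v, 'e) signed_graph \<Rightarrow> ('e \<Rightarrow> bool \<Rightarrow> int) \<Rightarrow> bool" where
  "orientation G eps \<longleftrightarrow>
     (\<forall>e\<in>edges G. (\<forall>b. eps e b \<in> {1, -1}) \<and> eps e True * eps e False = - sign G e)"

definition sink :: "('v, 'e) signed_graph \<Rightarrow> ('e \<Rightarrow> bool \<Rightarrow> int) \<Rightarrow> 'v \<Rightarrow> bool" where
  "sink G eps v \<longleftrightarrow> v \<in> verts G \<and> (\<forall>e\<in>edges G. \<forall>b. ends G e b = v \<longrightarrow> eps e b = -1)"

definition source :: "('v, 'e) signed_graph \<Rightarrow> ('e \<Rightarrow> bool \<Rightarrow> int) \<Rightarrow> 'v \<Rightarrow> bool" where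
  "source G eps v \<longleftrightarrow> v \<in> verts G \<and> (\<forall>e\<in>edges G. \<forall>b. ends G e b = v \<longrightarrow> eps e b = 1)"


section \<open>Walks\<close>

(* The walk u_0 x_1 u_1 ... x_n u_n with n = len W, u_i = vtx W i and x_i = edg W i.
   "exit_end W i" is the end of x_i by which the walk leaves u_{i-1}; it is determined by the
   vertices and edges unless x_i is a loop. *)
record ('v, 'e) walk =
  len :: nat
  vtx :: "nat \<Rightarrow> 'v"
  edg :: "nat \<Rightarrow> 'e"
  exit_end :: "nat \<Rightarrow> bool"

definition is_walk :: "('v, 'e) signed_graph \<Rightarrow> ('v, 'e) walk \<Rightarrow> bool" where
  "is_walk G W \<longleftrightarrow>
     vtx W 0 \<in> verts G \<and>
     (\<forall>i\<in>{1..len W}. edg W i \<in> edges G \<and>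
        ends G (edg W i) (exit_end W i) = vtx W (i - 1) \<and>
        ends G (edg W i) (\<not> exit_end W i) = vtx W i)"

definition walk_graph :: "('v, 'e) signed_graph \<Rightarrow> ('v, 'e) walk \<Rightarrow> ('v, 'e) signed_graph" where
  "walk_graph G W = G\<lparr>verts := vtx W ` {0..len W}, edges := edg W ` {1..len W}\<rparr>"

(* eps_out is the value on the pair (u_{i-1}, x_i), eps_in the value on (u_i, x_i). *)
definition eps_out :: "('v, 'e) walk \<Rightarrow> ('e \<Rightarrow> bool \<Rightarrow> int) \<Rightarrow> nat \<Rightarrow> int" where
  "eps_out W eps i = eps (edg W i) (exit_end W i)"

definition eps_in :: "('v, 'e) walk \<Rightarrow> ('e \<Rightarrow> bool \<Rightarrow> int) \<Rightarrow> nat \<Rightarrow> int" where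
  "eps_in W eps i = eps (edg W i) (\<not> exit_end W i)"

(* The values are attached to vertex-edge pairs, not to the positions of the walk.  With one value
   per position, going along an edge and straight back, u x v x u, would be a directed closed walk
   without double vertices. *)
definition walk_direction ::
  "('v, 'e) signed_graph \<Rightarrow> ('v, 'e) walk \<Rightarrow> ('e \<Rightarrow> bool \<Rightarrow> int) \<Rightarrow> bool" where
  "walk_direction G W eps \<longleftrightarrow>
     (\<forall>i\<in>{1..len W}. eps_out W eps i \<in> {1, -1} \<and> eps_in W eps i \<in> {1, -1} \<and>
        eps_out W eps i * eps_in W eps i = - sign G (edg W i)) \<and>
     (\<forall>i\<in>{1..<len W}. eps_in W eps i + eps_out W eps (i + 1) = 0)"

definition directed_closed_walk ::
  "('v, 'e) signed_graph \<Rightarrow> ('v, 'e) walk \<Rightarrow> ('e \<Rightarrow> bool \<Rightarrow> int) \<Rightarrow> bool" where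
  "directed_closed_walk G W eps \<longleftrightarrow>
     is_walk G W \<and> walk_direction G W eps \<and> len W \<ge> 1 \<and>
     vtx W 0 = vtx W (len W) \<and> eps_out W eps 1 + eps_in W eps (len W) = 0"

definition midway_back_avoided :: "('v, 'e) walk \<Rightarrow> ('e \<Rightarrow> bool \<Rightarrow> int) \<Rightarrow> bool" where
  "midway_back_avoided W eps \<longleftrightarrow>
     (\<forall>\<alpha> \<beta>. \<alpha> < \<beta> \<and> \<beta> < len W \<and> vtx W \<alpha> = vtx W \<beta> \<longrightarrow> eps_in W eps \<beta> = eps_out W eps (\<alpha> + 1))"

definition double_vertex :: "('v, 'e) walk \<Rightarrow> 'v \<Rightarrow> bool" where
  "double_vertex W v \<longleftrightarrow> card {i. i < len W \<and> vtx W i = v} = 2"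

definition uses :: "('v, 'e) walk \<Rightarrow> 'e \<Rightarrow> nat" where
  "uses W e = card {i \<in> {1..len W}. edg W i = e}"

(* The edge by which a closed walk continues after x_i. *)
definition next_edg :: "('v, 'e) walk \<Rightarrow> nat \<Rightarrow> 'e" where
  "next_edg W i = (if i = len W then edg W 1 else edg W (i + 1))"


section \<open>Cycle-trees\<close>

definition is_cycle :: "('v, 'e) signed_graph \<Rightarrow> bool" where
  "is_cycle C \<longleftrightarrow> wf_signed_graph C \<and>
     (\<exists>W. is_walk C W \<and> len W \<ge> 1 \<and> vtx W 0 = vtx W (len W) \<and>
          inj_on (vtx W) {0..<len W} \<and> inj_on (edg W) {1..len W} \<and> walk_graph C W = C)"

definition balanced :: "('v, 'e) signed_graph \<Rightarrow> bool" where
  "balanced C \<longleftrightarrow> (\<Prod>e\<in>edges C. sign C e) = 1"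

(* P is a simple path with end-vertices a and b; length 0 (a = b, no edges) is allowed. *)
definition simple_path :: "('v, 'e) signed_graph \<Rightarrow> 'v \<Rightarrow> 'v \<Rightarrow> bool" where
  "simple_path P a b \<longleftrightarrow> wf_signed_graph P \<and>
     (\<exists>W. is_walk P W \<and> vtx W 0 = a \<and> vtx W (len W) = b \<and>
          inj_on (vtx W) {0..len W} \<and> walk_graph P W = P)"

definition intersection_vertex ::
  "('v, 'e) signed_graph set \<Rightarrow> ('v, 'e) signed_graph set \<Rightarrow> 'v \<Rightarrow> bool" where
  "intersection_vertex \<C> \<P> v \<longleftrightarrow>
     (\<exists>C\<in>\<C>. \<exists>C'\<in>\<C>. C \<noteq> C' \<and> v \<in> verts C \<inter> verts C') \<or>
     (\<exists>P\<in>\<P>. \<exists>w. simple_path P v w)"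

(* T is a cycle-tree with set \<C> of block cycles and set \<P> of block paths. *)
definition cycle_tree ::
  "('v, 'e) signed_graph \<Rightarrow> ('v, 'e) signed_graph set \<Rightarrow> ('v, 'e) signed_graph set \<Rightarrow> bool" where
  "cycle_tree T \<C> \<P> \<longleftrightarrow>
     wf_signed_graph T \<and> connected_graph T \<and>
     \<C> = {C. subgraph C T \<and> is_cycle C} \<and>
     (\<forall>P\<in>\<P>. subgraph P T \<and> (\<exists>a b. simple_path P a b)) \<and>
     verts T = (\<Union>B\<in>\<C> \<union> \<P>. verts B) \<and>
     edges T = (\<Union>B\<in>\<C> \<union> \<P>. edges B) \<and>
     (\<forall>B\<in>\<C> \<union> \<P>. \<forall>B'\<in>\<C> \<union> \<P>. B \<noteq> B' \<longrightarrow> edges B \<inter> edges B' = {}) \<and>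
     (\<forall>P\<in>\<P>. \<forall>P'\<in>\<P>. P \<noteq> P' \<longrightarrow> verts P \<inter> verts P' = {}) \<and>
     (\<forall>C\<in>\<C>. \<forall>C'\<in>\<C>. C \<noteq> C' \<longrightarrow> card (verts C \<inter> verts C') \<le> 1) \<and>
     (\<forall>P\<in>\<P>. \<exists>a b C C'. simple_path P a b \<and> C \<noteq> C' \<and>
        {D \<in> \<C>. verts D \<inter> verts P \<noteq> {}} = {C, C'} \<and>
        verts C \<inter> verts P = {a} \<and> verts C' \<inter> verts P = {b}) \<and>
     (\<forall>v. intersection_vertex \<C> \<P> v \<longrightarrow> cut_point T v)"

definition eulerian_cycle_tree ::
  "('v, 'e) signed_graph \<Rightarrow> ('v, 'e) signed_graph set \<Rightarrow> ('v, 'e) signed_graph set \<Rightarrow> bool" where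
  "eulerian_cycle_tree T \<C> \<P> \<longleftrightarrow>
     cycle_tree T \<C> \<P> \<and>
     (\<forall>C\<in>\<C>. (balanced C \<longrightarrow> even (card {v \<in> verts C. intersection_vertex \<C> \<P> v})) \<and>
             (\<not> balanced C \<longrightarrow> odd (card {v \<in> verts C. intersection_vertex \<C> \<P> v})))"

definition cycle_tree_direction ::
  "('v, 'e) signed_graph \<Rightarrow> ('v, 'e) signed_graph set \<Rightarrow> ('e \<Rightarrow> bool \<Rightarrow> int) \<Rightarrow> bool" where
  "cycle_tree_direction T \<C> eps \<longleftrightarrow>
     orientation T eps \<and>
     (\<forall>v\<in>verts T. \<not> sink T eps v \<and> \<not> source T eps v) \<and>
     (\<forall>C\<in>\<C>. \<forall>v\<in>verts C. cut_point T v \<longrightarrow> sink C eps v \<or> source C eps v)"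

(* Every time the closed walk W passes a cut-point v of T, it goes from one to the other of
   exactly two blocks of T at v.  Here the blocks of T are the maximal nonseparable subgraphs:
   the block cycles and the single edges of the block paths (inner vertices of block paths are
   cut-points too).  At intersection vertices, W also changes between the parts of the
   decomposition into block cycles and block paths. *)
definition crosses_at_cut_points ::
  "('v, 'e) signed_graph \<Rightarrow> ('v, 'e) signed_graph set \<Rightarrow> ('v, 'e) signed_graph set \<Rightarrow>
   ('v, 'e) walk \<Rightarrow> bool" where
  "crosses_at_cut_points T \<C> \<P> W \<longleftrightarrow>
     (\<forall>i\<in>{1..len W}. cut_point T (vtx W i) \<longrightarrow>
        (\<exists>B B'. B \<noteq> B' \<and> {D. block T D \<and> vtx W i \<in> verts D} = {B, B'} \<and>
           edg W i \<in> edges B \<and> next_edg W i \<in> edges B') \<and>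
        (intersection_vertex \<C> \<P> (vtx W i) \<longrightarrow>
           (\<exists>B\<in>\<C> \<union> \<P>. \<exists>B'\<in>\<C> \<union> \<P>. B \<noteq> B' \<and> edg W i \<in> edges B \<and> next_edg W i \<in> edges B')))"

end

theory Submission
  imports Defs "HOL-Combinatorics.Orbits"
begin

text \<open>Midway-back avoidance makes the walk visit a vertex at most twice, with opposite values, and
  the cut-point hypothesis says that these double visits are pairwise non-crossing chords of the
  cyclic sequence of positions. Turning at every double vertex from one visit to the other therefore
  defines a permutation of the steps whose orbits visit distinct vertices. These orbits are the
  blocks: a nonseparable subgraph lies on one side of every double vertex it contains, hence inside
  one orbit. An orbit that repeats an edge consists of the two traversals of a bridge; all others are
  the block cycles, and the block paths are the maximal runs of bridges.\<close>

section \<open>Signed graphs\<close>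

text \<open>Deleting a double vertex leaves the two stretches of positions between its visits, each
  connected in itself. A vertex common to both stretches would reconnect them, and an empty stretch
  would leave nothing to separate; so the cut-point hypothesis forbids crossing chords and also
  loops at double vertices. The non-crossing property makes each side of a double vertex closed
  under turning, which keeps an orbit from meeting both visits of a vertex. Since the values of
  \<open>eps\<close> belong to edge-ends, an edge can only be repeated in the opposite direction,
  and its second traversal is then the turn of the first; hence the two-element orbits. The delicate
  part concerns the bridges: a maximal run of them must have a beginning, must not return to itself,
  and must end in two different cycles. The first holds because an innermost chord cannot start with
  a bridge, the second because retracing would have to reverse somewhere inside the run, and the
  third because the whole run stays on one side of its first vertex while the cycle at its start
  lies on the other.\<close>

lemma subgraph_antisym: "subgraph A B \<Longrightarrow> subgraph B A \<Longrightarrow> A = B"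
  by (auto simp: subgraph_def)

lemma subgraph_eqI: "subgraph A B \<Longrightarrow> verts B \<subseteq> verts A \<Longrightarrow> edges B \<subseteq> edges A \<Longrightarrow> A = B"
  by (auto simp: subgraph_def)

lemma sym_adj: "sym (adj G)"
  unfolding adj_def by (rule symI) fastforce

lemma adj_rtrancl_sym: "(a, b) \<in> (adj G)\<^sup>* \<Longrightarrow> (b, a) \<in> (adj G)\<^sup>*"
  by (meson sym_adj sym_rtrancl symE)

lemma equiv_reachable:
  "equiv (verts G) {(u, v). u \<in> verts G \<and> v \<in> verts G \<and> (u, v) \<in> (adj G)\<^sup>*}"
  by (rule equivI) (auto intro!: refl_onI symI transI intro: adj_rtrancl_sym)

text \<open>The bound is \<open>\<le> 1\<close> rather than \<open>= 1\<close> because the lemma is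
  applied to graphs with a vertex deleted, and these may be empty and then have no component at
  all.\<close>

lemma card_components_le_1_iff:
  assumes "finite (verts G)"
  shows "card (components G) \<le> 1 \<longleftrightarrow> (\<forall>a\<in>verts G. \<forall>b\<in>verts G. (a, b) \<in> (adj G)\<^sup>*)"
proof -
  define r where "r = {(u, v). u \<in> verts G \<and> v \<in> verts G \<and> (u, v) \<in> (adj G)\<^sup>*}"
  have comp: "components G = (\<lambda>a. r `` {a}) ` verts G"
    by (auto simp: components_def quotient_def r_def)
  have "card (components G) \<le> 1 \<longleftrightarrow> (\<forall>a\<in>verts G. \<forall>b\<in>verts G. r `` {a} = r `` {b})"
    using assms by (simp add: comp card_le_Suc0_iff_eq)
  also have "\<dots> \<longleftrightarrow> (\<forall>a\<in>verts G. \<forall>b\<in>verts G. (a, b) \<in> r)"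
    using eq_equiv_class_iff[OF equiv_reachable[of G, folded r_def]] by simp
  finally show ?thesis by (simp add: r_def)
qed

lemma components_empty_iff: "components G = {} \<longleftrightarrow> verts G = {}"
  unfolding components_def quotient_def by auto

lemma connected_graph_iff:
  assumes "finite (verts G)"
  shows "connected_graph G \<longleftrightarrow>
    verts G \<noteq> {} \<and> (\<forall>a\<in>verts G. \<forall>b\<in>verts G. (a, b) \<in> (adj G)\<^sup>*)"
proof -
  have "finite (components G)"
    unfolding components_def quotient_def using assms by auto
  then have "card (components G) = 0 \<longleftrightarrow> verts G = {}"
    by (simp add: components_empty_iff)
  then show ?thesis
    unfolding connected_graph_def card_components_le_1_iff[OF assms, symmetric] by linarith
qed

lemma adjI: "e \<in> edges G \<Longrightarrow> (ends G e c, ends G e (\<not> c)) \<in> adj G"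
  unfolding adj_def by blast

lemma adj_chain:
  assumes "i \<le> j" "\<And>k. i \<le> k \<Longrightarrow> k < j \<Longrightarrow> (f k, f (Suc k)) \<in> R"
  shows "(f i, f j) \<in> R\<^sup>*"
  using assms
proof (induction j)
  case (Suc j)
  show ?case
  proof (cases "i = Suc j")
    case False
    then have "(f i, f j) \<in> R\<^sup>*" "(f j, f (Suc j)) \<in> R"
      using Suc by auto
    then show ?thesis by simp
  qed simp
qed simp

lemma reachable_if_chain:
  assumes V: "verts G = f ` {..<m::nat}"
    and step: "\<And>k. Suc k < m \<Longrightarrow> (f k, f (Suc k)) \<in> adj G"
    and "a \<in> verts G" "b \<in> verts G"
  shows "(a, b) \<in> (adj G)\<^sup>*"
proof -
  have *: "(f 0, f j) \<in> (adj G)\<^sup>*" if "j < m" for j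
    using that by (intro adj_chain) (auto intro: step)
  obtain i j where "i < m" "j < m" "a = f i" "b = f j"
    using assms by auto
  then show ?thesis using *[of i] *[of j] by (meson adj_rtrancl_sym rtrancl_trans)
qed

lemma walk_graph_sel:
  "verts (walk_graph G Y) = vtx Y ` {0..len Y}" "edges (walk_graph G Y) = edg Y ` {1..len Y}"
  "ends (walk_graph G Y) = ends G" "signed_graph.sign (walk_graph G Y) = signed_graph.sign G"
  by (simp_all add: walk_graph_def)

text \<open>An edge-end is a pair of an edge and one of its two ends; a loop contributes two of them.\<close>

lemma cycle_two_edge_ends:
  assumes "is_cycle C" "v \<in> verts C"
  shows "\<exists>e c f d. (e, c) \<noteq> (f, d) \<and> e \<in> edges C \<and> f \<in> edges C \<and> ends C e c = v \<and> ends C f d = v"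
proof -
  obtain Y where Y: "is_walk C Y" "len Y \<ge> 1" "vtx Y 0 = vtx Y (len Y)"
      "inj_on (edg Y) {1..len Y}" "walk_graph C Y = C"
    using assms(1) unfolding is_cycle_def by blast
  have "verts C = vtx Y ` {0..len Y}"
    using walk_graph_sel(1)[of C Y] Y(5) by simp
  then obtain i0 where i0: "i0 \<le> len Y" "vtx Y i0 = v" using assms(2) by auto
  \<comment> \<open>The starting index 0 is traded for the closing index \<open>len Y\<close>, so
    that some edge \<open>edg Y i\<close> arrives at \<open>v\<close>; \<open>j\<close> is the
    cyclically following edge, which leaves \<open>v\<close>.\<close>
  define i where "i = (if i0 = 0 then len Y else i0)"
  have i: "i \<in> {1..len Y}" "vtx Y i = v" using i0 Y(2,3) by (auto simp: i_def)
  define j where "j = (if i = len Y then 1 else Suc i)"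
  have j: "j \<in> {1..len Y}" "vtx Y (j - 1) = v" using i Y(2,3) by (auto simp: j_def)
  have ei: "edg Y i \<in> edges C" "ends C (edg Y i) (\<not> exit_end Y i) = v"
    using Y(1) i unfolding is_walk_def by auto
  have ej: "edg Y j \<in> edges C" "ends C (edg Y j) (exit_end Y j) = v"
    using Y(1) j unfolding is_walk_def by auto
  have "(edg Y i, \<not> exit_end Y i) \<noteq> (edg Y j, exit_end Y j)"
    using inj_onD[OF Y(4) _ i(1) j(1)] by auto
  then show ?thesis using ei ej by (intro exI conjI)
qed

lemma is_cycle_nonempty: "is_cycle C \<Longrightarrow> verts C \<noteq> {}"
  unfolding is_cycle_def is_walk_def by auto

text \<open>The ends of a path enter \<open>intersection_vertex\<close> through an arbitrary
  witnessing walk, so they have to be recognised from the graph alone. An edge other than the first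
  joins vertices of positive index, which differ from the start.\<close>

lemma simple_path_end_unique_edge:
  assumes "simple_path P a c"
    and "e \<in> edges P" "f \<in> edges P" "ends P e b = a" "ends P f d = a"
  shows "e = f"
proof -
  obtain Y where Y: "is_walk P Y" "vtx Y 0 = a" "inj_on (vtx Y) {0..len Y}" "walk_graph P Y = P"
    using assms(1) unfolding simple_path_def by blast
  have *: "e' = edg Y 1" if "e' \<in> edges P" "ends P e' b' = a" for e' b'
  proof -
    have "e' \<in> edg Y ` {1..len Y}"
      using that(1) walk_graph_sel(2)[of P Y] Y(4) by simp
    then obtain i where i: "i \<in> {1..len Y}" "e' = edg Y i" by blast
    have "ends P e' (exit_end Y i) = vtx Y (i - 1)" "ends P e' (\<not> exit_end Y i) = vtx Y i"
      using Y(1) i unfolding is_walk_def by auto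
    then have "vtx Y (i - 1) = vtx Y 0 \<or> vtx Y i = vtx Y 0"
      using that(2) Y(2) by (cases "b' = exit_end Y i") auto
    then have "i - 1 = 0 \<or> i = 0"
      using Y(3) i(1) by (auto dest!: inj_onD)
    then show ?thesis using i by auto
  qed
  show ?thesis using *[of e b] *[of f d] assms by simp
qed

lemma simple_path_end_vert: "simple_path P a c \<Longrightarrow> a \<in> verts P"
  unfolding simple_path_def is_walk_def by auto

text \<open>A closed cyclic list of vertices stays a chain when one of them is removed. Indices run
  over all naturals, with \<open>f\<close> periodic, so that the remaining chain can start right
  after the removed vertex. The edges \<open>e j\<close> may repeat: the back-and-forth traversal of
  a bridge is covered with \<open>k = 2\<close>.\<close>

lemma nonseparableI_cyclic:
  assumes V: "verts H = f ` {..<k}" and "0 < k" and inj: "inj_on f {..<k}"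
    and per: "\<And>j. f (j + k) = f j"
    and e: "\<And>j. e j \<in> edges H \<and> ends H (e j) (c j) = f j \<and> ends H (e j) (\<not> c j) = f (Suc j)"
  shows "nonseparable H"
proof -
  have adjf: "(f j, f (Suc j)) \<in> adj H" for j
    using e[of j] adjI[of "e j" H "c j"] by simp
  have con: "connected_graph H"
    using reachable_if_chain[OF V adjf] \<open>0 < k\<close> by (auto simp: connected_graph_iff V)
  have "\<not> cut_point H v" for v
  proof
    assume cut: "cut_point H v"
    then obtain i where i: "i < k" "v = f i" by (auto simp: cut_point_def V)
    \<comment> \<open>The vertices other than \<open>v\<close>, listed from the one after
      \<open>v\<close>; the list of \<open>k - 1\<close> entries stops before the index returns to
      \<open>i\<close> modulo \<open>k\<close>.\<close>
    define g where "g j = f (Suc i + j)" for j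
    have g_ne: "g j \<noteq> v" if "j < k - 1" for j
    proof (cases "Suc i + j < k")
      case True
      then show ?thesis using i inj_onD[OF inj, of "Suc i + j" i] by (auto simp: g_def)
    next
      case False
      then have "g j = f (Suc i + j - k)"
        using per[of "Suc i + j - k"] by (simp add: g_def)
      moreover have "Suc i + j - k < i" using that False by auto
      ultimately show ?thesis
        using i inj_onD[OF inj, of "Suc i + j - k" i] by auto
    qed
    have "verts (delete_vertex H v) = g ` {..<k - 1}"
    proof (intro equalityI subsetI)
      fix a assume "a \<in> verts (delete_vertex H v)"
      then obtain m where m: "m < k" "m \<noteq> i" "a = f m"
        using i by (auto simp: delete_vertex_def V)
      show "a \<in> g ` {..<k - 1}"
      proof (cases "i < m")
        case True
        then show ?thesis using m by (intro image_eqI[of _ _ "m - Suc i"]) (auto simp: g_def)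
      next
        case False
        then have "Suc i + (m + k - Suc i) = m + k" "m + k - Suc i < k - 1" using m i by auto
        then show ?thesis
          using m per[of m] by (intro image_eqI[of _ _ "m + k - Suc i"]) (auto simp: g_def)
      qed
    next
      fix a assume "a \<in> g ` {..<k - 1}"
      then obtain j where j: "j < k - 1" "a = g j" by auto
      have "f m \<in> verts H" for m
      proof (induction m rule: less_induct)
        case (less m)
        then show ?case
          using per[of "m - k"] less[of "m - k"] \<open>0 < k\<close> by (cases "m < k") (auto simp: V)
      qed
      then show "a \<in> verts (delete_vertex H v)"
        using j g_ne by (simp add: delete_vertex_def g_def)
    qed
    moreover have "(g j, g (Suc j)) \<in> adj (delete_vertex H v)" if "Suc j < k - 1" for j
    proof -
      have E: "e (Suc i + j) \<in> edges H" "ends H (e (Suc i + j)) (c (Suc i + j)) = g j"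
          "ends H (e (Suc i + j)) (\<not> c (Suc i + j)) = g (Suc j)"
        using e[of "Suc i + j"] by (simp_all add: g_def)
      then have "ends H (e (Suc i + j)) d \<noteq> v" for d
        using g_ne[of j] g_ne[of "Suc j"] that by (cases "d = c (Suc i + j)") auto
      then have "e (Suc i + j) \<in> edges (delete_vertex H v)"
        using E by (simp add: delete_vertex_def)
      from adjI[OF this, of "c (Suc i + j)"] show ?thesis
        using E by (simp add: delete_vertex_def)
    qed
    ultimately have "card (components (delete_vertex H v)) \<le> 1"
      using reachable_if_chain[of "delete_vertex H v" g "k - 1"]
        card_components_le_1_iff[of "delete_vertex H v"] by simp
    then show False using cut con by (simp add: cut_point_def connected_graph_def)
  qed
  then show ?thesis using con by (simp add: nonseparable_def)
qed

lemma cycle_nonseparable: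
  assumes "is_cycle C"
  shows "nonseparable C"
proof -
  obtain Y where Y: "is_walk C Y" "len Y \<ge> 1" "vtx Y 0 = vtx Y (len Y)"
      "inj_on (vtx Y) {0..<len Y}" "walk_graph C Y = C"
    using assms unfolding is_cycle_def by blast
  define k where "k = len Y"
  have k: "0 < k" "vtx Y k = vtx Y 0" using Y by (auto simp: k_def)
  have nextv: "vtx Y (Suc j mod k) = vtx Y (Suc (j mod k))" for j
    using k by (auto simp: mod_Suc)
  show ?thesis
  proof (rule nonseparableI_cyclic)
    have "verts C = vtx Y ` {0..k}"
      using walk_graph_sel(1)[of C Y] Y(5) by (simp add: k_def)
    also have "\<dots> = vtx Y ` {..<k}"
    proof -
      have "{0..k} = insert k {..<k}" by auto
      then show ?thesis using k by auto
    qed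
    finally show "verts C = (\<lambda>j. vtx Y (j mod k)) ` {..<k}" by simp
    show "inj_on (\<lambda>j. vtx Y (j mod k)) {..<k}"
      using Y(4) by (auto simp: inj_on_def k_def)
    show "edg Y (Suc (j mod k)) \<in> edges C \<and>
        ends C (edg Y (Suc (j mod k))) (exit_end Y (Suc (j mod k))) = vtx Y (j mod k) \<and>
        ends C (edg Y (Suc (j mod k))) (\<not> exit_end Y (Suc (j mod k))) = vtx Y (Suc j mod k)" for j
    proof -
      have "Suc (j mod k) \<in> {1..len Y}" using k by (auto simp: k_def Suc_le_eq)
      then show ?thesis using Y(1) unfolding is_walk_def nextv by auto
    qed
  qed (use k in auto)
qed


section \<open>Positions of the walk\<close>

locale tame_walk =
  fixes G :: "('v, 'e) signed_graph" and W :: "('v, 'e) walk" and eps :: "'e \<Rightarrow> bool \<Rightarrow> int"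
  assumes wf: "wf_signed_graph G"
    and closed: "directed_closed_walk G W eps"
    and avoids: "midway_back_avoided W eps"
    and double_cut: "\<And>v. double_vertex W v \<Longrightarrow> cut_point (walk_graph G W) v"
begin

abbreviation n where "n \<equiv> len W"

abbreviation T where "T \<equiv> walk_graph G W"

abbreviation u where "u \<equiv> vtx W"

text \<open>Steps are indexed by the position they leave, so step \<open>p\<close> has edge \<^term>\<open>edg W (Suc p)\<close>.\<close>

definition x where "x p = edg W (Suc p)"

definition b where "b p = exit_end W (Suc p)"

definition nxt where "nxt p = Suc p mod n"

text \<open>Keeping the values at the starting ends loses nothing: directedness of the closed walk
  makes the value at the far end of step \<open>p\<close> equal to
  \<open>- out (nxt p)\<close>.\<close>

abbreviation out where "out p \<equiv> eps (x p) (b p)"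

text \<open>The default \<open>p\<close> makes \<open>twin p \<noteq> p\<close> the test for a
  double vertex. The choice of another visit is unambiguous, since a vertex turns out to have at
  most two.\<close>

definition twin where
  "twin p = (if \<exists>q<n. q \<noteq> p \<and> u q = u p then SOME q. q < n \<and> q \<noteq> p \<and> u q = u p else p)"

text \<open>After step \<open>p\<close> the walk crosses at a double vertex; \<open>turn\<close> leaves through the other visit
  of that vertex instead, and thereby stays in the block.\<close>

definition turn where "turn p = (if p < n then twin (nxt p) else p)"

definition retraced where "retraced = {p. p < n \<and> (\<exists>q<n. q \<noteq> p \<and> x q = x p)}"

lemma n_pos: "0 < n"
  using closed by (simp add: directed_closed_walk_def)

lemma nxt_less [simp]: "nxt p < n"
  using n_pos by (simp add: nxt_def)

lemma nxt_eq: "p < n \<Longrightarrow> nxt p = (if Suc p = n then 0 else Suc p)"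
  by (auto simp: nxt_def)

lemma nxt_inj: "p < n \<Longrightarrow> q < n \<Longrightarrow> nxt p = nxt q \<Longrightarrow> p = q"
  by (auto simp: nxt_eq split: if_splits)

lemma u_nxt: "p < n \<Longrightarrow> u (Suc p) = u (nxt p)"
  using closed by (auto simp: nxt_eq directed_closed_walk_def)

lemma step:
  assumes "p < n"
  shows "x p \<in> edges G" "ends G (x p) (b p) = u p" "ends G (x p) (\<not> b p) = u (nxt p)"
  using assms closed u_nxt[OF assms]
  by (auto simp: directed_closed_walk_def is_walk_def x_def b_def)

lemma verts_T: "verts T = u ` {..<n}"
proof -
  have "{0..n} = insert n {..<n}" by auto
  moreover have "u n = u 0" using closed by (simp add: directed_closed_walk_def)
  ultimately show ?thesis using n_pos by (auto simp: walk_graph_sel)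
qed

lemma edges_T: "edges T = x ` {..<n}"
proof -
  have "{1..n} = Suc ` {..<n}" by (metis One_nat_def image_Suc_lessThan)
  then show ?thesis by (auto simp: walk_graph_sel x_def)
qed

lemma ends_T [simp]: "ends T = ends G" and sign_T [simp]: "signed_graph.sign T = signed_graph.sign G"
  by (simp_all add: walk_graph_sel)

lemma wf_T: "wf_signed_graph T"
  unfolding wf_signed_graph_def
proof (intro conjI ballI allI)
  fix e c assume "e \<in> edges T"
  then obtain p where "p < n" "e = x p" by (auto simp: edges_T)
  then show "ends T e c \<in> verts T"
    using step[of p] by (cases "c = b p") (auto simp: verts_T)
next
  fix e assume "e \<in> edges T"
  then show "signed_graph.sign T e \<in> {1, -1}"
    using wf step by (auto simp: edges_T wf_signed_graph_def)
qed (simp_all add: verts_T edges_T)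

section \<open>Values of the direction at repeated visits\<close>

lemma eps_step:
  assumes "p < n"
  shows "out p \<in> {1, -1}" "eps (x p) (\<not> b p) = - out (nxt p)"
    "signed_graph.sign G (x p) = out p * out (nxt p)"
proof -
  have p: "Suc p \<in> {1..n}" using assms by auto
  have wd: "walk_direction G W eps" using closed by (simp add: directed_closed_walk_def)
  then have "out p \<in> {1,-1}" and sg: "out p * eps (x p) (\<not> b p) = - signed_graph.sign G (x p)"
    using p unfolding walk_direction_def eps_in_def eps_out_def x_def b_def by blast+
  then show "out p \<in> {1,-1}" by simp
  show in_eps: "eps (x p) (\<not> b p) = - out (nxt p)"
  proof (cases "Suc p = n")
    case True
    then show ?thesis
      using closed assms unfolding directed_closed_walk_def eps_in_def eps_out_def x_def b_def
      by (simp add: nxt_eq)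
  next
    case False
    then have "Suc p \<in> {1..<n}" using assms by auto
    then have "eps_in W eps (Suc p) + eps_out W eps (Suc p + 1) = 0"
      using wd unfolding walk_direction_def by blast
    then show ?thesis
      using False assms by (simp add: eps_in_def eps_out_def x_def b_def nxt_eq)
  qed
  show "signed_graph.sign G (x p) = out p * out (nxt p)"
    using sg in_eps by simp
qed

text \<open>Avoidance equates the value of arrival at the later visit with the value of departure at
  the earlier one, and in a directed walk the departure at the later visit is opposite to its
  arrival.\<close>

lemma out_double:
  assumes "p < n" "q < n" "p \<noteq> q" "u p = u q"
  shows "out q = - out p"
proof -
  have *: "out q = - out p" if less: "p < q" "q < n" "u p = u q" for p q
  proof -
    obtain r where r: "q = Suc r" using less by (cases q) auto
    have "eps_in W eps q = eps_out W eps (Suc p)"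
      using avoids less unfolding midway_back_avoided_def by simp
    then have "eps (x r) (\<not> b r) = out p"
      by (simp add: r eps_in_def eps_out_def x_def b_def)
    moreover have "nxt r = q" using r less by (simp add: nxt_eq)
    ultimately show ?thesis using eps_step(2)[of r] r less by simp
  qed
  show ?thesis
    using *[of p q] *[of q p] assms by (cases "p < q") auto
qed

lemma out_nonzero: "p < n \<Longrightarrow> out p \<noteq> 0"
  using eps_step(1)[of p] by auto

text \<open>Three visits would carry three nonzero values that are pairwise opposite.\<close>

lemma at_most_two:
  assumes "p < n" "q < n" "r < n" "u p = u q" "u p = u r" "q \<noteq> p" "r \<noteq> p"
  shows "q = r"
  using out_double[of p q] out_double[of p r] out_double[of q r] out_nonzero[of q] assms by force

lemma twin_cases:
  assumes "p < n"
  shows "twin p < n" "u (twin p) = u p"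
    and "q < n \<Longrightarrow> u q = u p \<Longrightarrow> q = p \<or> q = twin p"
proof -
  have *: "twin p < n \<and> twin p \<noteq> p \<and> u (twin p) = u p" if "\<exists>q<n. q \<noteq> p \<and> u q = u p"
    using someI_ex[of "\<lambda>q. q < n \<and> q \<noteq> p \<and> u q = u p"] that by (simp add: twin_def)
  then show "twin p < n" "u (twin p) = u p"
    using assms by (cases "\<exists>q<n. q \<noteq> p \<and> u q = u p"; force simp: twin_def)+
  assume q: "q < n" "u q = u p"
  show "q = p \<or> q = twin p"
  proof (cases "q = p")
    case False
    then show ?thesis using * q assms at_most_two[of p q "twin p"] by metis
  qed simp
qed

lemma twin_eqI: "p < n \<Longrightarrow> q < n \<Longrightarrow> u q = u p \<Longrightarrow> q \<noteq> p \<Longrightarrow> twin p = q"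
  using twin_cases(3) by blast

lemma twin_twin [simp]: "p < n \<Longrightarrow> twin (twin p) = p"
  by (cases "twin p = p") (auto intro: twin_eqI twin_cases simp: twin_cases(2))

lemma out_twin: "p < n \<Longrightarrow> twin p \<noteq> p \<Longrightarrow> out (twin p) = - out p"
  using out_double twin_cases by metis

lemma double_vertex_iff:
  assumes "p < n"
  shows "double_vertex W (u p) \<longleftrightarrow> twin p \<noteq> p"
proof -
  have "{i. i < n \<and> u i = u p} = {p, twin p}"
    using twin_cases[OF assms] assms by auto
  then show ?thesis by (auto simp: double_vertex_def card_insert_if)
qed

lemma turn_less [simp]: "p < n \<Longrightarrow> turn p < n"
  by (simp add: turn_def twin_cases)

lemma u_turn: "p < n \<Longrightarrow> u (turn p) = u (nxt p)"
  by (simp add: turn_def twin_cases)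

text \<open>On the positions, \<open>turn\<close> is the cyclic shift followed by the involution
  \<open>twin\<close>; off them it is the identity, as \<open>permutes\<close> demands.\<close>

lemma turn_permutes: "turn permutes {..<n}"
proof (rule bij_imp_permutes)
  have "inj_on turn {..<n}"
  proof (rule inj_onI)
    fix p q assume pq: "p \<in> {..<n}" "q \<in> {..<n}" "turn p = turn q"
    then have "twin (twin (nxt p)) = twin (twin (nxt q))" by (simp add: turn_def)
    then show "p = q" using pq nxt_inj by simp
  qed
  moreover have "turn ` {..<n} \<subseteq> {..<n}" by auto
  ultimately show "bij_betw turn {..<n} {..<n}"
    by (simp add: bij_betw_def endo_inj_surj)
qed (simp add: turn_def)

lemma permutation_turn: "permutation turn"
  using turn_permutes permutation_permutes by blast

lemma nxt_surj: "p < n \<Longrightarrow> \<exists>q<n. nxt q = p"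
  by (cases p) (use n_pos in \<open>auto simp: nxt_eq intro: exI[of _ "n - 1"] exI[of _ "p - 1"]\<close>)

section \<open>Deleting a vertex: cut-points and non-crossing chords\<close>

lemma adj_T_avoiding:
  assumes "p < n" "u p \<noteq> v" "u (nxt p) \<noteq> v"
  shows "(u p, u (nxt p)) \<in> adj (delete_vertex T v)"
proof -
  have "ends G (x p) c \<noteq> v" for c
    using step[OF assms(1)] assms by (cases "c = b p") auto
  then have "x p \<in> edges (delete_vertex T v)"
    using assms(1) by (simp add: delete_vertex_def edges_T)
  from adjI[OF this, of "b p"] show ?thesis
    using step[OF assms(1)] by (simp add: delete_vertex_def)
qed

lemma connected_T: "connected_graph T"
proof -
  have "(a, c) \<in> (adj T)\<^sup>*" if "a \<in> verts T" "c \<in> verts T" for a c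
  proof (rule reachable_if_chain[OF verts_T _ that])
    fix k assume k: "Suc k < n"
    have "(ends T (x k) (b k), ends T (x k) (\<not> b k)) \<in> adj T"
      by (rule adjI) (use k in \<open>auto simp: edges_T\<close>)
    then show "(u k, u (Suc k)) \<in> adj T" using step[of k] k by (simp add: nxt_eq)
  qed
  then show ?thesis
    using wf_T n_pos by (auto simp: connected_graph_iff wf_signed_graph_def) (auto simp: verts_T)
qed

lemma cut_point_T_iff:
  "cut_point T v \<longleftrightarrow> v \<in> verts T \<and>
    \<not> (\<forall>a\<in>verts T - {v}. \<forall>c\<in>verts T - {v}. (a, c) \<in> (adj (delete_vertex T v))\<^sup>*)"
proof -
  have "finite (verts (delete_vertex T v))" by (simp add: delete_vertex_def verts_T)
  from card_components_le_1_iff[OF this] show ?thesis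
    using connected_T unfolding cut_point_def connected_graph_def
    by (auto simp: delete_vertex_def)
qed

lemma reach_inside:
  assumes "p \<le> q" "q < n" "\<And>r. p \<le> r \<Longrightarrow> r \<le> q \<Longrightarrow> u r \<noteq> v"
  shows "(u p, u q) \<in> (adj (delete_vertex T v))\<^sup>*"
proof (rule adj_chain[OF assms(1)])
  fix k assume "p \<le> k" "k < q"
  then show "(u k, u (Suc k)) \<in> adj (delete_vertex T v)"
    using adj_T_avoiding[of k v] assms by (simp add: nxt_eq)
qed

lemma reach_outside:
  assumes "\<alpha> \<le> \<beta>" "\<beta> < n" "\<And>r. r < n \<Longrightarrow> u r = v \<Longrightarrow> \<alpha> \<le> r \<and> r \<le> \<beta>"
    and p: "p < n" "p < \<alpha> \<or> \<beta> < p" and q: "q < n" "q < \<alpha> \<or> \<beta> < q"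
  shows "(u p, u q) \<in> (adj (delete_vertex T v))\<^sup>*"
proof -
  have *: "(u p, u q) \<in> (adj (delete_vertex T v))\<^sup>*"
    if p: "p < \<alpha> \<or> \<beta> < p" and q: "q < n" "q < \<alpha> \<or> \<beta> < q" and "p \<le> q" for p q
  proof (cases "p < \<alpha> \<longleftrightarrow> q < \<alpha>")
    case True
    have "u r \<noteq> v" if "p \<le> r" "r \<le> q" for r
      using assms(3)[of r] that True p q by fastforce
    then show ?thesis using reach_inside that by blast
  next
    case False
    then have pq: "p < \<alpha>" "\<beta> < q" using p q \<open>p \<le> q\<close> by auto
    have "u r \<noteq> v" if "r \<le> p" for r using assms(1,2) assms(3)[of r] that pq by fastforce
    then have "(u 0, u p) \<in> (adj (delete_vertex T v))\<^sup>*" "u 0 \<noteq> v"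
      using reach_inside[of 0 p v] pq q that by auto
    moreover have "u r \<noteq> v" if "q \<le> r" "r < n" for r using assms(3)[of r] that pq by fastforce
    then have "(u q, u (n - 1)) \<in> (adj (delete_vertex T v))\<^sup>*" "u (n - 1) \<noteq> v"
      using reach_inside[of q "n - 1" v] q by auto
    \<comment> \<open>The positions outside the interval form a single cyclic stretch: the chain
      runs from \<open>q\<close> up to \<open>n - 1\<close>, over the closing step to 0, and on to
      \<open>p\<close>.\<close>
    moreover have "(u (n - 1), u 0) \<in> adj (delete_vertex T v)"
      using adj_T_avoiding[of "n - 1" v] calculation n_pos by (simp add: nxt_eq)
    ultimately have "(u q, u p) \<in> (adj (delete_vertex T v))\<^sup>*"
      by (meson rtrancl.rtrancl_into_rtrancl rtrancl_trans)
    then show ?thesis by (rule adj_rtrancl_sym)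
  qed
  show ?thesis
    using *[of p q] *[of q p] p q adj_rtrancl_sym by (cases "p \<le> q") auto
qed

text \<open>If a vertex is visited only at \<open>p\<close>, removing that one position from the
  cyclic sequence leaves a single chain, so the rest stays connected. The other direction is the
  hypothesis on double vertices.\<close>

lemma cut_point_iff_double:
  assumes "p < n"
  shows "cut_point T (u p) \<longleftrightarrow> twin p \<noteq> p"
proof
  assume "cut_point T (u p)"
  show "twin p \<noteq> p"
  proof
    assume single: "twin p = p"
    have "(a, c) \<in> (adj (delete_vertex T (u p)))\<^sup>*"
      if a: "a \<in> verts T - {u p}" and c: "c \<in> verts T - {u p}" for a c
    proof -
      obtain q r where qr: "q < n" "a = u q" "r < n" "c = u r"
        using a c by (auto simp: verts_T)
      then have "q \<noteq> p" "r \<noteq> p" using a c by auto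
      moreover have "s = p" if "s < n" "u s = u p" for s
        using twin_cases(3)[OF assms that] single by simp
      ultimately have "(u q, u r) \<in> (adj (delete_vertex T (u p)))\<^sup>*"
        by (intro reach_outside[of p p]) (use qr assms in auto)
      then show ?thesis using qr by simp
    qed
    then show False using \<open>cut_point T (u p)\<close> by (auto simp: cut_point_T_iff)
  qed
next
  assume "twin p \<noteq> p"
  then show "cut_point T (u p)" using double_cut double_vertex_iff[OF assms] by simp
qed

text \<open>Deleting the double vertex leaves an inner and an outer chain of positions, each
  connected. Since the vertex is a cut-point, neither chain can be empty and no vertex can lie on
  both.\<close>

lemma double_inside_outside:
  assumes "\<alpha> < \<beta>" "\<beta> < n" "u \<alpha> = u \<beta>"
  shows "\<exists>p q. \<alpha> < p \<and> p < \<beta> \<and> q < n \<and> (q < \<alpha> \<or> \<beta> < q)"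
    and "\<alpha> < p \<Longrightarrow> p < \<beta> \<Longrightarrow> q < n \<Longrightarrow> q < \<alpha> \<or> \<beta> < q \<Longrightarrow> u p \<noteq> u q"
proof -
  let ?v = "u \<alpha>"
  let ?R = "(adj (delete_vertex T ?v))\<^sup>*"
  have \<alpha>: "\<alpha> < n" using assms by simp
  have tw: "twin \<alpha> = \<beta>" using assms by (intro twin_eqI) auto
  have occ: "r = \<alpha> \<or> r = \<beta>" if "r < n" "u r = ?v" for r
    using twin_cases(3)[OF \<alpha> that] tw by simp
  have "cut_point T ?v" using cut_point_iff_double[OF \<alpha>] tw assms by simp
  then obtain a c where ac: "a \<in> verts T - {?v}" "c \<in> verts T - {?v}" "(a, c) \<notin> ?R"
    by (auto simp: cut_point_T_iff)
  have inside: "(u p, u q) \<in> ?R" if "\<alpha> < p" "p < \<beta>" "\<alpha> < q" "q < \<beta>" for p q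
  proof -
    have *: "(u p, u q) \<in> ?R" if "\<alpha> < p" "p \<le> q" "q < \<beta>" for p q
    proof (rule reach_inside)
      show "u r \<noteq> ?v" if "p \<le> r" "r \<le> q" for r
        using occ[of r] that assms \<open>\<alpha> < p\<close> \<open>q < \<beta>\<close> by auto
    qed (use that assms in auto)
    show ?thesis using *[of p q] *[of q p] adj_rtrancl_sym that by (cases "p \<le> q") auto
  qed
  have outside: "(u p, u q) \<in> ?R" if "p < n" "p < \<alpha> \<or> \<beta> < p" "q < n" "q < \<alpha> \<or> \<beta> < q" for p q
    by (intro reach_outside[of \<alpha> \<beta>]) (use that assms in \<open>auto dest!: occ\<close>)
  obtain s t where st: "s < n" "t < n" "a = u s" "c = u t" using ac by (auto simp: verts_T)
  then have ne: "s \<noteq> \<alpha>" "s \<noteq> \<beta>" "t \<noteq> \<alpha>" "t \<noteq> \<beta>" using ac assms by auto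
  have dif: "(\<alpha> < s \<and> s < \<beta>) \<noteq> (\<alpha> < t \<and> t < \<beta>)"
    using inside[of s t] outside[of s t] ac(3) st ne by auto
  show "\<exists>p q. \<alpha> < p \<and> p < \<beta> \<and> q < n \<and> (q < \<alpha> \<or> \<beta> < q)"
    using dif ne st by (metis nat_neq_iff)
  assume pq: "\<alpha> < p" "p < \<beta>" "q < n" "q < \<alpha> \<or> \<beta> < q"
  show "u p \<noteq> u q"
  proof
    assume eq: "u p = u q"
    have "(u p, u r) \<in> ?R" if "r < n" "r \<noteq> \<alpha>" "r \<noteq> \<beta>" for r
      using inside[of p r] outside[of q r] that pq eq by (cases "\<alpha> < r \<and> r < \<beta>") auto
    then have "(u p, a) \<in> ?R" "(u p, c) \<in> ?R" using st ne by auto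
    then show False using ac adj_rtrancl_sym rtrancl_trans by metis
  qed
qed

text \<open>A loop at a double vertex would place its two visits at cyclically consecutive
  positions, so that one of the two chains would be empty.\<close>

lemma no_loop:
  assumes "p < n" "twin p \<noteq> p"
  shows "u (nxt p) \<noteq> u p"
proof
  assume eq: "u (nxt p) = u p"
  have "n \<noteq> 1"
    using assms twin_cases(1)[of p] by auto
  then have "nxt p \<noteq> p" using assms by (auto simp: nxt_eq)
  then show False
    using eq assms double_inside_outside(1)[of p "nxt p"] double_inside_outside(1)[of "nxt p" p]
    by (auto simp: nxt_eq split: if_splits)
qed


section \<open>Blocks as orbits\<close>

text \<open>At a double vertex the walk splits into two closed walks; \<open>side p\<close> is the one that leaves
  the vertex by step \<open>p\<close>.\<close>

definition side where
  "side p = (if p < twin p then {p..<twin p} else {..<n} - {twin p..<p})"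

lemma side_twin_eq: "p < n \<Longrightarrow> twin p \<noteq> p \<Longrightarrow> side (twin p) = {..<n} - side p"
  using twin_cases(1)[of p] by (auto simp: side_def)

lemma side_self: "p < n \<Longrightarrow> twin p \<noteq> p \<Longrightarrow> p \<in> side p \<and> twin p \<notin> side p"
  by (auto simp: side_def)

lemma side_less: "p < n \<Longrightarrow> q \<in> side p \<Longrightarrow> q < n"
  using twin_cases(1)[of p] by (auto simp: side_def split: if_splits)

lemma side_vert:
  assumes "p < n" "twin p \<noteq> p" "q \<in> side p" "u q = u p"
  shows "q = p"
  using twin_cases(3)[OF assms(1), of q] side_less[OF assms(1,3)] side_self assms by auto

lemma side_nxt:
  assumes "p < n" "twin p \<noteq> p" "q \<in> side p"
  shows "nxt q = twin p \<or> nxt q \<in> side p - {p}"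
  using assms side_less[OF assms(1,3)] twin_cases(1)[of p] n_pos
  by (auto simp: side_def nxt_eq split: if_splits)

lemma sides_disjoint:
  assumes "p < n" "twin p \<noteq> p" "q \<in> side p" "q \<noteq> p" "r \<in> side (twin p)" "r \<noteq> twin p"
  shows "u q \<noteq> u r"
proof -
  have "twin p < n" "u (twin p) = u p" "r < n" "q < n"
    using assms twin_cases(1,2)[of p] side_less[of p q] side_less[of "twin p" r] by auto
  then show ?thesis
    using double_inside_outside(2)[of p "twin p" q r] double_inside_outside(2)[of "twin p" p r q]
      assms by (auto simp: side_def split: if_splits)
qed

text \<open>The chord from \<open>q\<close> to its twin cannot cross the chord at \<open>p\<close>:
  a visit on the other side would give a vertex shared by both sides.\<close>

lemma twin_in_side:
  assumes "p < n" "twin p \<noteq> p" "q \<in> side p" "q \<noteq> p"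
  shows "twin q \<in> side p"
proof (rule ccontr)
  assume "twin q \<notin> side p"
  have q: "q < n" using side_less assms by blast
  then have "twin q \<in> side (twin p)"
    using \<open>twin q \<notin> side p\<close> side_twin_eq twin_cases(1) assms by simp
  moreover have "twin q \<noteq> twin p" using q assms by (metis twin_twin)
  ultimately show False using sides_disjoint[of p q "twin q"] assms twin_cases(2)[OF q] by simp
qed

text \<open>The walk leaves the side only on reaching \<open>twin p\<close>, and there
  \<open>turn\<close> leads back to \<open>p\<close> instead. All other chords stay inside the
  side.\<close>

lemma turn_in_side:
  assumes "p < n" "twin p \<noteq> p" "q \<in> side p"
  shows "turn q \<in> side p"
  using side_nxt[OF assms] twin_in_side[of p "nxt q"] side_self[of p] side_less[OF assms(1,3)] assms
  by (auto simp: turn_def)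

lemma orbit_in_side:
  assumes "p < n" "twin p \<noteq> p" "q \<in> side p"
  shows "orbit turn q \<subseteq> side p"
proof
  fix r assume "r \<in> orbit turn q"
  then show "r \<in> side p" by induction (use assms turn_in_side in auto)
qed

lemma orbit_self: "p \<in> orbit turn p"
  by (rule permutation_self_in_orbit[OF permutation_turn])

lemma orbit_eq: "q \<in> orbit turn p \<Longrightarrow> orbit turn q = orbit turn p"
  by (rule orbit_cyclic_eq3[OF cyclic_on_orbit'[OF permutation_turn]])

lemma orbit_turn: "orbit turn (turn p) = orbit turn p"
  by (intro orbit_eq orbit.base)

lemma orbit_less: "p < n \<Longrightarrow> q \<in> orbit turn p \<Longrightarrow> q < n"
  using permutes_orbit_subset[OF turn_permutes] by auto

lemma twin_not_in_orbit:
  assumes "p < n" "twin p \<noteq> p"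
  shows "twin p \<notin> orbit turn p"
  using orbit_in_side[OF assms] side_self[OF assms] by auto

text \<open>Two positions of the orbit at the same vertex would be twins, but the orbit of
  \<open>q\<close> is confined to \<open>side q\<close>, which misses \<open>twin q\<close>.\<close>

lemma inj_on_orbit:
  assumes "p < n"
  shows "inj_on u (orbit turn p)"
proof (rule inj_onI)
  fix q r assume qr: "q \<in> orbit turn p" "r \<in> orbit turn p" "u q = u r"
  then have "q < n" "r < n" using orbit_less assms by auto
  then show "q = r"
    using twin_cases(3)[of q r] twin_not_in_orbit[of q] qr orbit_eq[of q p] by force
qed

lemma orbit_enumeration:
  obtains k where "0 < k" "(turn ^^ k) p = p" "orbit turn p = (\<lambda>j. (turn ^^ j) p) ` {..<k}"
    "inj_on (\<lambda>j. (turn ^^ j) p) {..<k}"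
proof
  show "0 < funpow_dist1 turn p p" by simp
  show "(turn ^^ funpow_dist1 turn p p) p = p"
    by (rule funpow_dist1_prop[OF orbit_self])
  show "orbit turn p = (\<lambda>j. (turn ^^ j) p) ` {..<funpow_dist1 turn p p}"
    using orbit_conv_funpow_dist1[OF orbit_self] by (simp add: atLeast0LessThan)
  show "inj_on (\<lambda>j. (turn ^^ j) p) {..<funpow_dist1 turn p p}"
    using inj_on_funpow_dist1[OF orbit_self] by (simp add: atLeast0LessThan)
qed

text \<open>Two traversals in the same direction would give equal values of \<open>out\<close> at
  two visits of one vertex, against \<open>out_double\<close>. In opposite directions,
  \<open>q\<close> starts where \<open>p\<close> arrives, and it is not the next step, because
  consecutive values at a vertex are opposite while here both are the value of one edge-end. So
  \<open>q\<close> starts from the other visit, which is the turn of \<open>p\<close>.\<close>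

lemma repeated_edge:
  assumes "p < n" "q < n" "q \<noteq> p" "x q = x p"
  shows "q = turn p" "b q = (\<not> b p)" "twin p = nxt q" "twin p \<noteq> p"
proof -
  show bq: "b q = (\<not> b p)"
  proof (rule ccontr)
    assume "b q \<noteq> (\<not> b p)"
    then have "b q = b p" by auto
    then show False
      using out_double[of p q] step(2)[of p] step(2)[of q] assms out_nonzero[of p] by auto
  qed
  have *: "r = turn s" if "s < n" "r < n" "r \<noteq> s" "x r = x s" "b r = (\<not> b s)" for r s
  proof -
    have "u r = u (nxt s)" using step(2)[of r] step(3)[of s] that by simp
    moreover have "r \<noteq> nxt s"
      using eps_step(2)[OF that(1)] that out_nonzero[of r] by auto
    ultimately show ?thesis using that twin_eqI[of "nxt s" r] by (simp add: turn_def)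
  qed
  show "q = turn p" using * assms bq by simp
  have "p = turn q" using * assms bq by simp
  then have tw: "twin p = nxt q" using assms by (simp add: turn_def)
  then show "twin p = nxt q" .
  have "nxt q \<noteq> p"
    using eps_step(2)[OF assms(2)] assms bq out_nonzero[of p] by auto
  then show "twin p \<noteq> p" using tw by simp
qed

lemma same_edge_orbit: "p < n \<Longrightarrow> q < n \<Longrightarrow> x p = x q \<Longrightarrow> p \<in> orbit turn q"
  using repeated_edge(1)[of q p] orbit_self[of q] orbit.base[of turn q] by (cases "p = q") auto

lemma retraced_turn:
  assumes "p \<in> retraced"
  shows "p < n" "turn p \<in> retraced" "turn p \<noteq> p" "x (turn p) = x p" "b (turn p) = (\<not> b p)"
    "turn (turn p) = p" "twin p = nxt (turn p)" "twin p \<noteq> p" "orbit turn p = {p, turn p}"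
proof -
  obtain q where q: "p < n" "q < n" "q \<noteq> p" "x q = x p"
    using assms by (auto simp: retraced_def)
  note R = repeated_edge[OF q] and R' = repeated_edge[of q p]
  show "p < n" "turn p \<in> retraced" "turn p \<noteq> p" "x (turn p) = x p" "b (turn p) = (\<not> b p)"
    "twin p = nxt (turn p)" "twin p \<noteq> p"
    using R q by (auto simp: retraced_def)
  show tt: "turn (turn p) = p" using R(1) R'(1) q by metis
  have "orbit turn p \<subseteq> {p, turn p}"
  proof
    fix r assume "r \<in> orbit turn p" then show "r \<in> {p, turn p}" by induction (use tt in auto)
  qed
  then show "orbit turn p = {p, turn p}" using orbit_self orbit.base by force
qed

section \<open>The blocks are the graphs of the orbits\<close>

definition steps_graph where "steps_graph S = G\<lparr>verts := u ` S, edges := x ` S\<rparr>"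

abbreviation blk where "blk p \<equiv> steps_graph (orbit turn p)"

lemma steps_graph_sel [simp]:
  "verts (steps_graph S) = u ` S" "edges (steps_graph S) = x ` S"
  "ends (steps_graph S) = ends G" "signed_graph.sign (steps_graph S) = signed_graph.sign G"
  by (simp_all add: steps_graph_def)

lemma subgraph_TI:
  assumes "verts H \<subseteq> u ` {..<n}" "edges H = x ` S" "S \<subseteq> {..<n}"
    "\<And>q. q \<in> S \<Longrightarrow> u q \<in> verts H" "\<And>q. q \<in> S \<Longrightarrow> u (nxt q) \<in> verts H"
    "ends H = ends G" "signed_graph.sign H = signed_graph.sign G"
  shows "subgraph H T"
  unfolding subgraph_def wf_signed_graph_def
proof (intro conjI ballI allI)
  show "verts H \<subseteq> verts T" "edges H \<subseteq> edges T" using assms(1-3) by (auto simp: verts_T edges_T)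
  then show "finite (verts H)" "finite (edges H)"
    using finite_surj[of "{..<n}" "verts H" u] finite_surj[of "{..<n}" "edges H" x]
    by (simp_all add: verts_T edges_T)
  fix e assume "e \<in> edges H"
  then obtain q where q: "q \<in> S" "q < n" "e = x q" using assms(2,3) by auto
  show "ends H e c \<in> verts H" for c
    using step[OF q(2)] q assms(4-6) by (cases "c = b q") auto
  show "signed_graph.sign H e \<in> {1, -1}"
    using wf step q assms(7) by (auto simp: wf_signed_graph_def)
qed (use assms in auto)

text \<open>\<open>steps_graph\<close> collects only the starting vertices of steps. The arrival
  vertices are among them because \<open>turn q\<close> starts where \<open>q\<close> arrives and
  the orbit is closed under \<open>turn\<close>.\<close>

lemma subgraph_blk:
  assumes "p < n"
  shows "subgraph (blk p) T"
proof (rule subgraph_TI[where S = "orbit turn p"])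
  fix q assume q: "q \<in> orbit turn p"
  then show "u (nxt q) \<in> verts (blk p)"
    using u_turn[of q] orbit_less[OF assms q] orbit.step[OF q] by (metis imageI steps_graph_sel(1))
qed (use orbit_less[OF assms] in auto)

lemma step_funpow:
  assumes "p < n"
  shows "(turn ^^ j) p < n" "(turn ^^ j) p \<in> orbit turn p"
    "ends G (x ((turn ^^ j) p)) (b ((turn ^^ j) p)) = u ((turn ^^ j) p)"
    "ends G (x ((turn ^^ j) p)) (\<not> b ((turn ^^ j) p)) = u ((turn ^^ Suc j) p)"
proof -
  show "(turn ^^ j) p \<in> orbit turn p" by (rule funpow_in_orbit[OF orbit_self])
  then show "(turn ^^ j) p < n" using orbit_less assms by blast
  then show "ends G (x ((turn ^^ j) p)) (b ((turn ^^ j) p)) = u ((turn ^^ j) p)"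
    "ends G (x ((turn ^^ j) p)) (\<not> b ((turn ^^ j) p)) = u ((turn ^^ Suc j) p)"
    using step u_turn by auto
qed

lemma nonseparable_blk:
  assumes "p < n"
  shows "nonseparable (blk p)"
proof -
  obtain k where k: "0 < k" "(turn ^^ k) p = p" "orbit turn p = (\<lambda>j. (turn ^^ j) p) ` {..<k}"
    "inj_on (\<lambda>j. (turn ^^ j) p) {..<k}"
    using orbit_enumeration .
  show ?thesis
  proof (rule nonseparableI_cyclic)
    show "verts (blk p) = (\<lambda>j. u ((turn ^^ j) p)) ` {..<k}" by (simp add: k(3) image_image)
    show "inj_on (\<lambda>j. u ((turn ^^ j) p)) {..<k}"
      using comp_inj_on[OF k(4)] inj_on_orbit[OF assms] unfolding k(3) by (simp add: comp_def)
    show "u ((turn ^^ (j + k)) p) = u ((turn ^^ j) p)" for j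
      by (simp add: funpow_add k(2))
    show "x ((turn ^^ j) p) \<in> edges (blk p) \<and>
        ends (blk p) (x ((turn ^^ j) p)) (b ((turn ^^ j) p)) = u ((turn ^^ j) p) \<and>
        ends (blk p) (x ((turn ^^ j) p)) (\<not> b ((turn ^^ j) p)) = u ((turn ^^ Suc j) p)" for j
      using step_funpow[OF assms, of j] by simp
  qed (rule k(1))
qed

text \<open>The second part rests on the absence of loops at double vertices: every edge of a side
  has an end that survives the deletion of \<open>u p\<close>, so the side of the edge can still be
  read off there.\<close>

lemma side_ends:
  assumes "p < n" "twin p \<noteq> p" "q \<in> side p"
  shows "ends G (x q) c \<in> insert (u p) (u ` (side p - {p}))"
    and "\<exists>c. ends G (x q) c \<in> u ` (side p - {p})"
proof -
  have q: "q < n" using side_less assms by blast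
  have l: "u q \<in> insert (u p) (u ` (side p - {p}))" using assms by auto
  have r: "u (nxt q) \<in> insert (u p) (u ` (side p - {p}))"
    using side_nxt[OF assms] twin_cases(2)[OF assms(1)] by auto
  show "ends G (x q) c \<in> insert (u p) (u ` (side p - {p}))"
    using step[OF q] l r by (cases "c = b q") auto
  have "u q \<noteq> u p \<or> u (nxt q) \<noteq> u p"
    using side_vert[OF assms] no_loop[OF q] assms by auto
  then show "\<exists>c. ends G (x q) c \<in> u ` (side p - {p})"
    using l r step[OF q] by (metis insert_iff)
qed

text \<open>Deleting \<open>u p\<close> keeps \<open>D\<close> connected, while no edge avoiding
  \<open>u p\<close> joins the two sides. An edge of \<open>D\<close> on each side would leave a
  surviving vertex on each side, with no way from one to the other.\<close>

lemma nonseparable_one_side: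
  assumes D: "nonseparable D" "subgraph D T"
    and p: "p < n" "twin p \<noteq> p" "u p \<in> verts D"
    and q: "q \<in> side p" "x q \<in> edges D"
    and r: "r < n" "x r \<in> edges D"
  shows "r \<in> side p"
proof (rule ccontr)
  assume "r \<notin> side p"
  let ?V = "u ` (side p - {p})" and ?V' = "u ` (side (twin p) - {twin p})"
  have p': "twin p < n" "twin (twin p) \<noteq> twin p" "u (twin p) = u p"
    using p twin_cases by auto
  have other: "s \<in> side (twin p)" if "s < n" "s \<notin> side p" for s
    using that side_twin_eq p by simp
  have disj: "?V \<inter> ?V' = {}" using sides_disjoint[OF p(1,2)] by blast
  have not_v: "u p \<notin> ?V" "u p \<notin> ?V'"
    using side_vert[OF p(1,2)] side_vert[OF p'(1,2)] p'(3) by auto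
  have D': "finite (verts D)" "ends D = ends G" "edges D \<subseteq> x ` {..<n}"
    "\<And>e c. e \<in> edges D \<Longrightarrow> ends G e c \<in> verts D"
    using D(2) by (auto simp: subgraph_def wf_signed_graph_def edges_T)
  have "\<not> cut_point D (u p)" using D(1) by (simp add: nonseparable_def)
  then have "card (components (delete_vertex D (u p))) \<le> 1"
    using D(1) p(3) by (simp add: cut_point_def nonseparable_def connected_graph_def)
  moreover have "finite (verts (delete_vertex D (u p)))" using D' by (simp add: delete_vertex_def)
  ultimately have reach: "(a, c) \<in> (adj (delete_vertex D (u p)))\<^sup>*"
    if "a \<in> verts D - {u p}" "c \<in> verts D - {u p}" for a c
    using that by (simp add: card_components_le_1_iff[unfolded One_nat_def] delete_vertex_def)
  obtain c where c: "ends G (x q) c \<in> ?V" using side_ends(2)[OF p(1,2) q(1)] by blast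
  obtain d where d: "ends G (x r) d \<in> ?V'"
    using side_ends(2)[OF p'(1,2) other[OF r(1) \<open>r \<notin> side p\<close>]] by blast
  have "(ends G (x q) c, ends G (x r) d) \<in> (adj (delete_vertex D (u p)))\<^sup>*"
    using c d not_v D'(4) q r by (intro reach) auto
  then have "ends G (x r) d \<in> ?V"
  proof (induction rule: rtrancl_induct)
    case base
    show ?case by (rule c)
  next
    case (step y z)
    then obtain e f where e: "e \<in> edges D" "\<And>f. ends G e f \<noteq> u p"
        "y = ends G e f" "z = ends G e (\<not> f)"
      by (auto simp: adj_def delete_vertex_def D'(2))
    then obtain s where s: "s < n" "e = x s" using D'(3) by auto
    have "s \<in> side p"
    proof (rule ccontr)
      assume "s \<notin> side p"
      then have "y \<in> ?V'"
        using side_ends(1)[OF p'(1,2) other[OF s(1)], of f] e s p'(3) by auto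
      then show False using disj step.IH by blast
    qed
    then show ?case using side_ends(1)[OF p(1,2), of s "\<not> f"] e s by auto
  qed
  then show False using d disj by blast
qed

lemma step_end_orbit:
  assumes "p < n"
  obtains q where "q \<in> orbit turn p" "q < n" "u q = ends G (x p) c"
proof (cases "c = b p")
  case True
  then show ?thesis using that[of p] orbit_self assms step by simp
next
  case False
  then have "c = (\<not> b p)" by auto
  then show ?thesis using that[of "turn p"] orbit.base[of turn p] assms step u_turn by simp
qed

text \<open>The orbits of \<open>p\<close> and \<open>q\<close> visit the common end at positions
  \<open>p'\<close> and \<open>q'\<close>. Were these different, they would be twins, and the two
  edges would lie on opposite sides of that vertex.\<close>

lemma nonseparable_same_orbit:
  assumes D: "nonseparable D" "subgraph D T"
    and pq: "p < n" "q < n" "x p \<in> edges D" "x q \<in> edges D" "ends G (x p) c = ends G (x q) d"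
  shows "q \<in> orbit turn p"
proof -
  obtain p' where p': "p' \<in> orbit turn p" "p' < n" "u p' = ends G (x p) c"
    using step_end_orbit pq by metis
  obtain q' where q': "q' \<in> orbit turn q" "q' < n" "u q' = ends G (x q) d"
    using step_end_orbit pq by metis
  have orb: "orbit turn p' = orbit turn p" "orbit turn q' = orbit turn q"
    using p' q' orbit_eq by auto
  have "q' = p'"
  proof (rule ccontr)
    assume "q' \<noteq> p'"
    then have tw: "twin p' = q'" using p' q' pq by (intro twin_eqI) auto
    have p'D: "u p' \<in> verts D"
      using D(2) pq p' by (auto simp: subgraph_def wf_signed_graph_def)
    have tw': "twin p' \<noteq> p'" using tw \<open>q' \<noteq> p'\<close> by simp
    have "p \<in> side p'"
      using orbit_in_side[OF p'(2) tw'] side_self[OF p'(2) tw'] orb orbit_self by blast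
    moreover have "q \<in> side q'"
      using orbit_in_side[of q' q'] side_self[of q'] tw tw' p' q' orb orbit_self[of q]
      by (metis subsetD twin_twin)
    then have "q \<notin> side p'" using side_twin_eq[OF p'(2) tw'] tw by auto
    ultimately show False
      using nonseparable_one_side[OF D p'(2) tw' p'D, of p q] pq by blast
  qed
  then show ?thesis using orb orbit_self by metis
qed

lemma nonseparable_in_blk:
  assumes D: "nonseparable D" "subgraph D T"
  shows "\<exists>p<n. subgraph D (blk p)"
proof -
  have D': "finite (verts D)" "ends D = ends G" "edges D \<subseteq> x ` {..<n}" "verts D \<subseteq> u ` {..<n}"
    "signed_graph.sign D = signed_graph.sign G" "wf_signed_graph D"
    "\<And>e c. e \<in> edges D \<Longrightarrow> ends G e c \<in> verts D"
    using D(2) by (auto simp: subgraph_def wf_signed_graph_def edges_T verts_T)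
  have con: "verts D \<noteq> {}" "\<And>a c. a \<in> verts D \<Longrightarrow> c \<in> verts D \<Longrightarrow> (a, c) \<in> (adj D)\<^sup>*"
    using D(1) D'(1) by (auto simp: nonseparable_def connected_graph_iff)
  have goal: "subgraph D (blk p)"
    if "verts D \<subseteq> u ` orbit turn p" "edges D \<subseteq> x ` orbit turn p" for p
    using that D' by (simp add: subgraph_def)
  show ?thesis
  proof (cases "edges D = {}")
    case True
    \<comment> \<open>A connected graph without edges is a single vertex, so any block through it
      will do.\<close>
    obtain v where v: "v \<in> verts D" using con by blast
    then obtain p where p: "p < n" "v = u p" using D'(4) by auto
    have "adj D = {}" using True by (simp add: adj_def)
    then have "verts D \<subseteq> {v}" using con(2) v by auto
    then show ?thesis using goal[of p] p orbit_self True by blast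
  next
    case False
    then obtain p where p: "p < n" "x p \<in> edges D" using D'(3) by blast
    \<comment> \<open>The invariant carried along a path in \<open>D\<close>: the vertex is on the
      orbit of \<open>p\<close>, and every edge of \<open>D\<close> at it is an edge of that orbit.
      Passing to a neighbour uses the connecting edge as the new reference.\<close>
    define Q where "Q a \<longleftrightarrow> a \<in> u ` orbit turn p \<and>
      (\<forall>q<n. x q \<in> edges D \<and> (\<exists>d. ends G (x q) d = a) \<longrightarrow> q \<in> orbit turn p)" for a
    have "Q a" if "a \<in> verts D" for a
    proof -
      have "(u p, a) \<in> (adj D)\<^sup>*"
        using con(2) that D'(7)[OF p(2), of "b p"] step(2)[OF p(1)] by simp
      then show ?thesis
      proof (induction rule: rtrancl_induct)
        case base
        then show ?case
          using nonseparable_same_orbit[OF D p(1) _ p(2), where c = "b p"] step(2)[OF p(1)] orbit_self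
          by (simp add: Q_def) metis
      next
        case (step y z)
        then obtain e f where e: "e \<in> edges D" "y = ends G e f" "z = ends G e (\<not> f)"
          by (auto simp: adj_def D'(2))
        then obtain s where s: "s < n" "e = x s" using D'(3) by auto
        have so: "s \<in> orbit turn p" using step.IH e s by (auto simp: Q_def)
        obtain t where "t \<in> orbit turn s" "u t = z" using step_end_orbit[OF s(1), of "\<not> f"] e s by auto
        moreover have "q \<in> orbit turn s" if "q < n" "x q \<in> edges D" "ends G (x q) d = z" for q d
          using nonseparable_same_orbit[OF D s(1) that(1), of "\<not> f" d] e s that by simp
        ultimately show ?case unfolding Q_def orbit_eq[OF so, symmetric] by blast
      qed
    qed
    then have "verts D \<subseteq> u ` orbit turn p" by (auto simp: Q_def)
    moreover have "edges D \<subseteq> x ` orbit turn p"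
    proof
      fix e assume e: "e \<in> edges D"
      then obtain q where q: "q < n" "e = x q" using D'(3) by auto
      have "Q (ends G e True)" using D'(7)[OF e] \<open>\<And>a. a \<in> verts D \<Longrightarrow> Q a\<close> by blast
      then show "e \<in> x ` orbit turn p" using e q by (auto simp: Q_def)
    qed
    ultimately show ?thesis using goal p by blast
  qed
qed

lemma edge_in_blk:
  assumes "p < n" "q < n" "x p \<in> edges (blk q)"
  shows "p \<in> orbit turn q"
proof -
  obtain r where "r \<in> orbit turn q" "x p = x r" using assms(3) by auto
  then show ?thesis
    using same_edge_orbit[of p r] assms(1) orbit_less[OF assms(2)] orbit_eq[of r q] by simp
qed

lemma blk_eq_iff:
  assumes "p < n" "q < n"
  shows "blk p = blk q \<longleftrightarrow> orbit turn p = orbit turn q"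
proof
  assume "blk p = blk q"
  then have "p \<in> orbit turn q"
    using edge_in_blk[OF assms] orbit_self[of p] by (metis imageI steps_graph_sel(2))
  then show "orbit turn p = orbit turn q" by (rule orbit_eq)
qed simp

text \<open>A nonseparable subgraph lies in the graph of one orbit, and an edge determines its
  orbit. So a nonseparable graph containing an orbit graph cannot exceed it.\<close>

lemma block_iff: "block T D \<longleftrightarrow> (\<exists>p<n. D = blk p)"
proof
  assume "block T D"
  then have D: "nonseparable D" "subgraph D T"
    "\<And>H. subgraph H T \<Longrightarrow> nonseparable H \<Longrightarrow> subgraph D H \<Longrightarrow> H = D"
    by (auto simp: block_def)
  obtain p where "p < n" "subgraph D (blk p)" using nonseparable_in_blk[OF D(1,2)] by blast
  then show "\<exists>p<n. D = blk p" using D(3) subgraph_blk nonseparable_blk by metis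
next
  assume "\<exists>p<n. D = blk p"
  then obtain p where p: "p < n" "D = blk p" by blast
  have "H = blk p" if H: "subgraph H T" "nonseparable H" "subgraph (blk p) H" for H
  proof -
    obtain q where q: "q < n" "subgraph H (blk q)" using nonseparable_in_blk[OF H(2,1)] by blast
    have "x p \<in> edges (blk q)"
      using H(3) q(2) orbit_self[of p] by (auto simp: subgraph_def)
    then have "blk p = blk q"
      using edge_in_blk[OF p(1) q(1)] orbit_eq by auto
    then show ?thesis using q(2) H(3) subgraph_antisym by metis
  qed
  then show "block T D"
    using p subgraph_blk nonseparable_blk by (auto simp: block_def)
qed

text \<open>As the orbit visits each vertex once, its graph has at most two edge-ends there: the
  departure of \<open>q\<close> and the arrival of the predecessor of \<open>q\<close> under
  \<open>turn\<close>.\<close>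

lemma edge_end_in_blk:
  assumes "p < n" "q \<in> orbit turn p" "e \<in> edges (blk p)" "ends G e c = u q"
  shows "(e, c) = (x q, b q) \<or> (\<exists>r\<in>orbit turn p. turn r = q \<and> (e, c) = (x r, \<not> b r))"
proof -
  obtain r where r: "r \<in> orbit turn p" "e = x r" using assms(3) by auto
  then have "r < n" using orbit_less assms(1) by blast
  note inj = inj_onD[OF inj_on_orbit[OF assms(1)]]
  show ?thesis
  proof (cases "c = b r")
    case True
    then have "r = q" using inj[of r q] step[OF \<open>r < n\<close>] r assms by simp
    then show ?thesis using r True by simp
  next
    case False
    then have "c = (\<not> b r)" by auto
    moreover have "turn r = q"
      using inj[of "turn r" q] step[OF \<open>r < n\<close>] u_turn[OF \<open>r < n\<close>] orbit.step[OF r(1)] r assms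
        calculation by simp
    ultimately show ?thesis using r by blast
  qed
qed

text \<open>A retraced step has an orbit made of the two traversals of its edge, so an orbit
  containing one retraced step contains no other kind.\<close>

lemma inj_on_x_orbit:
  assumes "p < n" "p \<notin> retraced"
  shows "orbit turn p \<inter> retraced = {}" "inj_on x (orbit turn p)"
proof -
  show R: "orbit turn p \<inter> retraced = {}"
  proof (rule ccontr)
    assume "orbit turn p \<inter> retraced \<noteq> {}"
    then obtain q where q: "q \<in> orbit turn p" "q \<in> retraced" by blast
    then have "p \<in> {q, turn q}"
      using orbit_eq[OF q(1)] orbit_self[of p] retraced_turn(9)[OF q(2)] by simp
    then show False using q assms retraced_turn(2)[OF q(2)] by auto
  qed
  show "inj_on x (orbit turn p)"
    using R orbit_less[OF assms(1)] by (fastforce simp: inj_on_def retraced_def)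
qed

lemma is_cycle_blk:
  assumes "p < n" "p \<notin> retraced"
  shows "is_cycle (blk p)"
proof -
  obtain k where k: "0 < k" "(turn ^^ k) p = p" "orbit turn p = (\<lambda>j. (turn ^^ j) p) ` {..<k}"
    "inj_on (\<lambda>j. (turn ^^ j) p) {..<k}"
    using orbit_enumeration .
  define Y where "Y = \<lparr>len = k, vtx = \<lambda>j. u ((turn ^^ j) p),
    edg = \<lambda>j. x ((turn ^^ (j - 1)) p), exit_end = \<lambda>j. b ((turn ^^ (j - 1)) p)\<rparr>"
  have "is_walk (blk p) Y"
    unfolding is_walk_def
  proof (intro conjI ballI)
    fix i assume "i \<in> {1..len Y}"
    then obtain j where "i = Suc j" by (cases i) auto
    then show "edg Y i \<in> edges (blk p)" "ends (blk p) (edg Y i) (exit_end Y i) = vtx Y (i - 1)"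
      "ends (blk p) (edg Y i) (\<not> exit_end Y i) = vtx Y i"
      using step_funpow[OF assms(1), of j] by (auto simp: Y_def)
  qed (use orbit_self in \<open>auto simp: Y_def\<close>)
  moreover have "len Y \<ge> 1" "vtx Y 0 = vtx Y (len Y)" using k by (auto simp: Y_def)
  moreover have "inj_on (vtx Y) {0..<len Y}"
    using comp_inj_on[OF k(4)] inj_on_orbit[OF assms(1)] unfolding k(3)
    by (simp add: Y_def comp_def atLeast0LessThan)
  moreover have shift: "{Suc 0..k} = Suc ` {..<k}" by (simp add: image_Suc_lessThan)
  then have "inj_on (edg Y) {1..len Y}"
    using comp_inj_on[OF k(4)] inj_on_x_orbit(2)[OF assms] unfolding k(3)
    by (simp add: Y_def inj_on_def)
  moreover have "walk_graph (blk p) Y = blk p"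
  proof -
    have "{0..k} = insert k {..<k}" by auto
    then have "vtx Y ` {0..len Y} = insert (u p) (u ` orbit turn p)"
      using k(2) by (simp add: Y_def image_image k(3))
    then have "vtx Y ` {0..len Y} = u ` orbit turn p" using orbit_self[of p] by auto
    moreover have "edg Y ` {1..len Y} = x ` orbit turn p"
      unfolding k(3) by (simp add: Y_def shift image_image)
    ultimately show ?thesis by (simp add: walk_graph_def steps_graph_def)
  qed
  ultimately show ?thesis
    using subgraph_blk[OF assms(1)] unfolding is_cycle_def subgraph_def by blast
qed

text \<open>Being nonseparable, the cycle lies in one block. At each of its vertices it needs two
  edge-ends, and the block offers at most two, so the cycle contains both and propagates along
  \<open>turn\<close> through the whole orbit. In a retraced orbit the two edge-ends would be the
  same one.\<close>

lemma cycle_eq_blk: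
  assumes C: "is_cycle C" "subgraph C T"
  shows "\<exists>p<n. p \<notin> retraced \<and> C = blk p"
proof -
  obtain p where p: "p < n" "subgraph C (blk p)"
    using nonseparable_in_blk[OF cycle_nonseparable[OF C(1)] C(2)] by blast
  have sub: "verts C \<subseteq> u ` orbit turn p" "edges C \<subseteq> x ` orbit turn p" "ends C = ends G"
    "wf_signed_graph C"
    using p(2) by (auto simp: subgraph_def)
  have main: "x q \<in> edges C \<and> q \<notin> retraced" if q: "q \<in> orbit turn p" "u q \<in> verts C" for q
  proof -
    obtain e c f d where ef: "(e, c) \<noteq> (f, d)" "e \<in> edges C" "f \<in> edges C"
        "ends G e c = u q" "ends G f d = u q"
      using cycle_two_edge_ends[OF C(1) q(2)] sub(3) by auto
    have inj: "r = s" if "turn r = q" "turn s = q" for r s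
      using that permutes_inj[OF turn_permutes] by (metis injD)
    have "(e, c) = (x q, b q) \<or> (\<exists>r\<in>orbit turn p. turn r = q \<and> (e, c) = (x r, \<not> b r))"
      "(f, d) = (x q, b q) \<or> (\<exists>r\<in>orbit turn p. turn r = q \<and> (f, d) = (x r, \<not> b r))"
      using ef sub(2) by (intro edge_end_in_blk[OF p(1) q(1)]; force)+
    \<comment> \<open>The predecessor under \<open>turn\<close> is unique, so two distinct edge-ends
      cannot both be arrivals; one is the departure and the other the arrival.\<close>
    then obtain r where r: "turn r = q" "(x q, b q) \<noteq> (x r, \<not> b r)" "x q \<in> edges C"
      using ef inj by (metis prod.inject)
    have "q \<notin> retraced"
    proof
      assume "q \<in> retraced"
      then have "turn q = r" using retraced_turn(6)[of q] r(1) permutes_inj[OF turn_permutes] by (metis injD)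
      then show False using retraced_turn(4,5)[OF \<open>q \<in> retraced\<close>] r(2) by auto
    qed
    then show ?thesis using r by simp
  qed
  obtain q0 where q0: "q0 \<in> orbit turn p" "u q0 \<in> verts C"
    using is_cycle_nonempty[OF C(1)] sub(1) by blast
  have all: "u q \<in> verts C" if "q \<in> orbit turn p" for q
  proof -
    have next': "u (turn r) \<in> verts C" if r: "r \<in> orbit turn p" "u r \<in> verts C" for r
    proof -
      have "r < n" using r orbit_less p by blast
      then have "ends C (x r) (\<not> b r) = u (turn r)" using step u_turn sub(3) by simp
      then show ?thesis using main[OF r] sub(4) by (metis wf_signed_graph_def)
    qed
    have "q \<in> orbit turn q0" using orbit_eq[OF q0(1)] that by simp
    then show ?thesis
    proof induction
      case base
      then show ?case using next' q0 by blast
    next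
      case (step y)
      then show ?case using next' orbit_eq[OF q0(1)] by blast
    qed
  qed
  have "C = blk p"
    using main all by (intro subgraph_eqI[OF p(2)]) auto
  then show ?thesis using p(1) main[of p] all[of p] orbit_self by blast
qed

lemma cycles_T: "{C. subgraph C T \<and> is_cycle C} = blk ` ({..<n} - retraced)"
  using cycle_eq_blk is_cycle_blk subgraph_blk by fastforce


section \<open>Block paths as maximal runs of retraced steps\<close>

text \<open>Guarantees that a run of bridges has a beginning. Take a chord of least length: if its
  first step were retraced, the vertex after that step would be double too, and its chord would lie
  strictly inside.\<close>

lemma exists_not_retraced: "\<exists>z<n. z \<notin> retraced"
proof (cases "\<exists>p<n. p < twin p")
  case False
  have "0 \<notin> retraced"
    using retraced_turn(8)[of 0] False n_pos by auto
  then show ?thesis using n_pos by blast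
next
  case True
  then obtain p where p: "p < n" "p < twin p"
    and least: "\<And>q. q < n \<Longrightarrow> q < twin q \<Longrightarrow> twin p - p \<le> twin q - q"
    using ex_has_least_nat[of "\<lambda>p. p < n \<and> p < twin p" _ "\<lambda>p. twin p - p"] by blast
  have tw: "twin p < n" "twin p \<noteq> p" using p twin_cases by auto
  have nxt: "nxt p = Suc p" using p tw by (simp add: nxt_eq)
  have "p \<notin> retraced"
  proof
    assume "p \<in> retraced"
    note R = retraced_turn[OF this]
    let ?r = "Suc p"
    have r: "?r < n" "?r \<noteq> twin p"
      using no_loop[OF p(1) tw(2)] twin_cases(2)[OF p(1)] tw p nxt by auto
    have "turn p = twin ?r" using p nxt by (simp add: turn_def)
    moreover have "twin (turn p) \<noteq> turn p" using retraced_turn(8)[OF R(2)] .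
    ultimately have tr: "twin ?r \<noteq> ?r" using r by auto
    have "?r \<in> side p" using p r by (auto simp: side_def)
    then have "twin ?r \<in> side p" using twin_in_side[OF p(1) tw(2)] by simp
    moreover have "twin ?r \<noteq> p" using r by (metis twin_twin)
    ultimately have "?r < twin ?r" "twin ?r < twin p" using p tr by (auto simp: side_def)
    then show False using least[OF r(1)] by linarith
  qed
  then show ?thesis using p by blast
qed

lemma nxt_funpow_less: "p < n \<Longrightarrow> (nxt ^^ k) p < n"
  by (cases k) auto

lemma nxt_transitive:
  assumes "p < n" "q < n"
  shows "\<exists>k. (nxt ^^ k) p = q"
proof -
  have *: "(nxt ^^ k) p = (p + k) mod n" for k
    using assms by (induction k) (auto simp: nxt_def mod_Suc_eq)
  show ?thesis
    by (rule exI[of _ "n - p + q"]) (use assms in \<open>simp add: *\<close>)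
qed

definition bridge_adj where "bridge_adj = {(u p, u (nxt p)) | p. p \<in> retraced}"

text \<open>A component of the bridges, as a set of steps containing both traversals of each edge.
  This description makes distinct block paths disjoint at once; \<open>run\<close> supplies the
  linear order that shows each component to be a path.\<close>

definition path_steps where "path_steps p = {q \<in> retraced. (u p, u q) \<in> bridge_adj\<^sup>*}"

definition run where
  "run s m \<longleftrightarrow> (\<exists>z<n. z \<notin> retraced \<and> nxt z = s) \<and> 0 < m \<and>
    (\<forall>t<m. (nxt ^^ t) s \<in> retraced) \<and> (nxt ^^ m) s \<notin> retraced"

text \<open>The second traversal of a bridge, \<open>turn p\<close>, joins the same two vertices in
  the reverse order.\<close>

lemma sym_bridge_adj: "sym (bridge_adj\<^sup>*)"
proof (intro sym_rtrancl symI)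
  fix v w assume "(v, w) \<in> bridge_adj"
  then obtain p where p: "p \<in> retraced" "v = u p" "w = u (nxt p)" by (auto simp: bridge_adj_def)
  note R = retraced_turn[OF p(1)]
  have "u (nxt (turn p)) = u p" using R(1,7) twin_cases(2)[of p] by simp
  moreover have "(u (turn p), u (nxt (turn p))) \<in> bridge_adj"
    using R(2) by (auto simp: bridge_adj_def)
  ultimately show "(w, v) \<in> bridge_adj" using p u_turn[OF R(1)] by simp
qed

lemma path_steps_eq: "(u p, u q) \<in> bridge_adj\<^sup>* \<Longrightarrow> path_steps p = path_steps q"
  using sym_bridge_adj unfolding path_steps_def sym_def by (auto intro: rtrancl_trans)

lemma path_steps_shared:
  assumes "q \<in> path_steps p" "r \<in> path_steps p'" "u q = u r"
  shows "path_steps p = path_steps p'"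
  using assms path_steps_eq[of p q] path_steps_eq[of p' r] path_steps_eq[of q r]
  by (auto simp: path_steps_def)

lemma run_from:
  assumes z: "z < n" "z \<notin> retraced" "nxt z \<in> retraced"
  shows "\<exists>m. run (nxt z) m"
proof -
  define m where "m = (LEAST m. (nxt ^^ m) (nxt z) \<notin> retraced)"
  have "\<exists>m. (nxt ^^ m) (nxt z) \<notin> retraced"
    using nxt_transitive[OF nxt_less z(1)] z(2) by metis
  then have m: "(nxt ^^ m) (nxt z) \<notin> retraced" unfolding m_def by (rule LeastI_ex)
  then have "m \<noteq> 0" using z by (cases m) auto
  moreover have "(nxt ^^ t) (nxt z) \<in> retraced" if "t < m" for t
    using not_less_Least[of t "\<lambda>m. (nxt ^^ m) (nxt z) \<notin> retraced"] that by (auto simp: m_def)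
  ultimately have "run (nxt z) m" using m z by (auto simp: run_def)
  then show ?thesis by blast
qed

lemma run_reaching:
  assumes "p \<in> retraced"
  obtains s m where "run s m" "path_steps s = path_steps p"
proof -
  have p: "p < n" using retraced_turn(1)[OF assms] .
  \<comment> \<open>The least distance back to a step that is not retraced. By minimality every
    position after that step up to \<open>p\<close> is retraced, so a run starts right after it and
    connects to \<open>p\<close>.\<close>
  let ?K = "\<lambda>k. \<exists>z<n. z \<notin> retraced \<and> (nxt ^^ k) z = p"
  define k where "k = (LEAST k. ?K k)"
  have "\<exists>k. ?K k" using exists_not_retraced nxt_transitive p by metis
  then have "?K k" unfolding k_def by (rule LeastI_ex)
  then obtain z where z: "z < n" "z \<notin> retraced" "(nxt ^^ k) z = p" by blast
  have inner: "(nxt ^^ j) z \<in> retraced" if "0 < j" "j \<le> k" for j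
  proof (rule ccontr)
    assume "(nxt ^^ j) z \<notin> retraced"
    moreover have "(nxt ^^ (k - j)) ((nxt ^^ j) z) = p"
      using that z(3) by (metis add_diff_inverse_nat funpow_add le_add_diff_inverse2 not_less o_apply)
    ultimately have "?K (k - j)" using nxt_funpow_less[OF z(1)] by blast
    then have "k \<le> k - j" unfolding k_def by (rule Least_le)
    then show False using that by simp
  qed
  have "k \<noteq> 0" using z assms by (cases k) auto
  then obtain l where l: "k = Suc l" by (cases k) auto
  have shift: "(nxt ^^ j) (nxt z) = (nxt ^^ Suc j) z" for j by (simp add: funpow_swap1)
  have "(u ((nxt ^^ 0) (nxt z)), u ((nxt ^^ l) (nxt z))) \<in> bridge_adj\<^sup>*"
  proof (rule adj_chain[where f = "\<lambda>j. u ((nxt ^^ j) (nxt z))"])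
    fix j assume "j < l"
    then have "(nxt ^^ j) (nxt z) \<in> retraced" using inner[of "Suc j"] l by (simp add: funpow_swap1)
    then show "(u ((nxt ^^ j) (nxt z)), u ((nxt ^^ Suc j) (nxt z))) \<in> bridge_adj"
      by (auto simp: bridge_adj_def)
  qed simp
  then have eq: "path_steps (nxt z) = path_steps p"
    using path_steps_eq[of "nxt z" p] z(3) shift[of l] l by simp
  have "nxt z \<in> retraced" using inner[of 1] l by simp
  then obtain m where "run (nxt z) m" using run_from z by blast
  then show ?thesis using that eq by blast
qed

lemma turn_inj: "turn p = turn q \<Longrightarrow> p = q"
  using permutes_inj[OF turn_permutes] by (metis injD)

lemma turn_retraced_iff: "turn p \<in> retraced \<longleftrightarrow> p \<in> retraced"
  using retraced_turn(2,6) turn_inj by metis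

lemma retraced_nxt_double:
  assumes "p \<in> retraced"
  shows "twin (nxt p) = turn p" "twin (nxt p) \<noteq> nxt p"
proof -
  note R = retraced_turn[OF assms]
  show tw: "twin (nxt p) = turn p" using R(1) by (simp add: turn_def)
  then show "twin (nxt p) \<noteq> nxt p" using retraced_turn(8)[OF R(2)] by auto
qed

context
  fixes s m
  assumes run: "run s m"
begin

lemma run_start: "s < n" "twin s \<notin> retraced"
proof -
  obtain z where z: "z < n" "z \<notin> retraced" "nxt z = s" using run by (auto simp: run_def)
  then show "s < n" by auto
  have "turn z = twin s" using z by (simp add: turn_def)
  then show "twin s \<notin> retraced" using z turn_retraced_iff by metis
qed

lemma run_less: "(nxt ^^ t) s < n"
  using nxt_funpow_less run_start(1) .

lemma run_retraced: "t < m \<Longrightarrow> (nxt ^^ t) s \<in> retraced"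
  using run by (simp add: run_def)

lemma run_end: "(nxt ^^ m) s \<notin> retraced"
  using run by (simp add: run_def)

lemma run_double:
  assumes "t \<le> m"
  shows "twin ((nxt ^^ t) s) \<noteq> (nxt ^^ t) s"
proof (cases "t < m")
  case True
  then show ?thesis using retraced_turn(8) run_retraced by blast
next
  case False
  then obtain t' where "t = Suc t'" "t' < m" using assms run by (cases t) (auto simp: run_def)
  then show ?thesis using retraced_nxt_double(2)[OF run_retraced] by simp
qed

text \<open>If a run came back to one of its vertices, then the steps between the two visits would
  retrace each other pairwise, and the innermost pair would be a loop or a step straight back.\<close>

lemma run_not_twin:
  assumes "t \<le> t'" "t' \<le> m"
  shows "twin ((nxt ^^ t) s) \<noteq> (nxt ^^ t') s"
  using assms
proof (induction "t' - t" arbitrary: t t' rule: less_induct)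
  case less
  show ?case
  proof
    assume eq: "twin ((nxt ^^ t) s) = (nxt ^^ t') s"
    have d: "twin ((nxt ^^ t) s) \<noteq> (nxt ^^ t) s" using run_double less.prems by simp
    then have "t < t'" using eq less.prems by (cases "t = t'") auto
    then obtain l where l: "t' = Suc l" "t \<le> l" by (cases t') auto
    have R: "(nxt ^^ t) s \<in> retraced" using run_retraced \<open>t < t'\<close> less.prems by simp
    have "nxt (turn ((nxt ^^ t) s)) = nxt ((nxt ^^ l) s)"
      using retraced_turn(7)[OF R] eq l by simp
    then have "turn ((nxt ^^ t) s) = (nxt ^^ l) s"
      using nxt_inj retraced_turn(1)[OF R] run_less turn_less by blast
    \<comment> \<open>The pair of twins moves inward by one step at both ends. It closes up at a
      loop if \<open>l = t\<close>, and at a position that would be its own twin if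
      \<open>l = Suc t\<close>, which \<open>run_double\<close> excludes.\<close>
    then have tw: "twin ((nxt ^^ Suc t) s) = (nxt ^^ l) s"
      using retraced_nxt_double(1)[OF R] by simp
    show False
    proof (cases "l = t")
      case True
      then have "u (nxt ((nxt ^^ t) s)) = u ((nxt ^^ t) s)"
        using twin_cases(2)[OF run_less[of t]] eq l by simp
      then show False using no_loop[OF run_less d] by simp
    next
      case False
      then have "Suc t \<le> l" "l - Suc t < t' - t" "l \<le> m" using l less.prems by auto
      then show False using less.hyps[of l "Suc t"] tw by blast
    qed
  qed
qed

text \<open>As \<open>nxt\<close> is injective, an equality of two positions can be pulled back to
  the start \<open>s\<close>; but the step before \<open>s\<close> is not retraced, while the step
  before any later position of the run is.\<close>

lemma run_distinct:
  assumes "t < t'" "t' \<le> m"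
  shows "(nxt ^^ t) s \<noteq> (nxt ^^ t') s"
  using assms
proof (induction t arbitrary: t')
  case 0
  obtain z where z: "z < n" "z \<notin> retraced" "nxt z = s" using run by (auto simp: run_def)
  obtain l where l: "t' = Suc l" using 0 by (cases t') auto
  then show ?case
    using nxt_inj[OF z(1) run_less[of l]] run_retraced[of l] 0 z by auto
next
  case (Suc t)
  obtain l where l: "t' = Suc l" using Suc by (cases t') auto
  then show ?case
    using nxt_inj[OF run_less[of t] run_less[of l]] Suc.IH[of l] Suc.prems by auto
qed

lemma inj_on_run: "inj_on (\<lambda>t. u ((nxt ^^ t) s)) {..m}"
proof -
  have ne: "u ((nxt ^^ t) s) \<noteq> u ((nxt ^^ t') s)" if "t < t'" "t' \<le> m" for t t'
    using twin_cases(3)[OF run_less[of t] run_less[of t']] run_distinct[OF that]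
      run_not_twin[of t t'] that by force
  show ?thesis
  proof (rule inj_onI)
    fix t t' assume "t \<in> {..m}" "t' \<in> {..m}" "u ((nxt ^^ t) s) = u ((nxt ^^ t') s)"
    then show "t = t'" using ne[of t t'] ne[of t' t] by (cases t t' rule: linorder_cases) auto
  qed
qed

text \<open>The two visits of a run vertex are the run position itself and its twin. The twin is the
  reverse traversal of the preceding run step, except at \<open>t = 0\<close>, where it is not
  retraced.\<close>

lemma run_retraced_at:
  assumes "t \<le> m" "p \<in> retraced" "u p = u ((nxt ^^ t) s)"
  shows "p = (nxt ^^ t) s \<and> t < m \<or> (\<exists>t'. t = Suc t' \<and> p = turn ((nxt ^^ t') s))"
proof -
  have "p = (nxt ^^ t) s \<or> p = twin ((nxt ^^ t) s)"
    using twin_cases(3)[OF run_less] retraced_turn(1) assms by blast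
  then show ?thesis
  proof
    assume "p = (nxt ^^ t) s"
    then show ?thesis using assms run_end by (cases "t = m") auto
  next
    assume p: "p = twin ((nxt ^^ t) s)"
    show ?thesis
    proof (cases t)
      case 0
      then show ?thesis using p assms run_start by simp
    next
      case (Suc t')
      then show ?thesis using p run_less[of t'] assms by (auto simp: turn_def)
    qed
  qed
qed

lemma run_not_retraced_at:
  assumes "t \<le> m" "p < n" "p \<notin> retraced" "u p = u ((nxt ^^ t) s)"
  shows "p = (nxt ^^ m) s \<and> t = m \<or> p = twin s \<and> t = 0"
proof -
  have "p = (nxt ^^ t) s \<or> p = twin ((nxt ^^ t) s)"
    using twin_cases(3)[OF run_less] assms by blast
  then show ?thesis
  proof
    assume "p = (nxt ^^ t) s"
    then show ?thesis using assms run_retraced by (cases "t = m") auto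
  next
    assume p: "p = twin ((nxt ^^ t) s)"
    show ?thesis
    proof (cases t)
      case (Suc t')
      then have "p = turn ((nxt ^^ t') s)" using p run_less[of t'] by (auto simp: turn_def)
      then show ?thesis using assms Suc run_retraced[of t'] turn_retraced_iff by auto
    qed (use p in simp)
  qed
qed

lemma run_in_path_steps: "t < m \<Longrightarrow> (nxt ^^ t) s \<in> path_steps s"
  using adj_chain[of 0 t "\<lambda>t. u ((nxt ^^ t) s)" bridge_adj] run_retraced
  by (fastforce simp: path_steps_def bridge_adj_def)

text \<open>The retraced steps available at a run vertex only move one place forwards or backwards
  in the run, so the component cannot leave it.\<close>

lemma verts_run: "u ` path_steps s = (\<lambda>t. u ((nxt ^^ t) s)) ` {..m}"
proof (intro equalityI subsetI)
  fix v assume "v \<in> u ` path_steps s"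
  then have "(u s, v) \<in> bridge_adj\<^sup>*" by (auto simp: path_steps_def)
  then show "v \<in> (\<lambda>t. u ((nxt ^^ t) s)) ` {..m}"
  proof (induction rule: rtrancl_induct)
    case base
    show ?case by (rule image_eqI[of _ _ 0]) auto
  next
    case (step y z)
    then obtain p t where p: "p \<in> retraced" "z = u (nxt p)" "t \<le> m" "u p = u ((nxt ^^ t) s)"
      by (auto simp: bridge_adj_def)
    from run_retraced_at[OF p(3,1,4)] show ?case
    proof (elim disjE exE conjE)
      assume "p = (nxt ^^ t) s" "t < m"
      then show ?thesis using p by (intro image_eqI[of _ _ "Suc t"]) auto
    next
      fix t' assume t': "t = Suc t'" "p = turn ((nxt ^^ t') s)"
      then have "(nxt ^^ t') s \<in> retraced" using p(3) run_retraced by simp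
      then have "u (nxt p) = u ((nxt ^^ t') s)"
        using retraced_turn(7) twin_cases(2)[OF run_less[of t']] t' by metis
      then show ?thesis using p t' by (intro image_eqI[of _ _ t']) auto
    qed
  qed
next
  fix v assume "v \<in> (\<lambda>t. u ((nxt ^^ t) s)) ` {..m}"
  then obtain t where t: "t \<le> m" "v = u ((nxt ^^ t) s)" by auto
  show "v \<in> u ` path_steps s"
  proof (cases "t < m")
    case True
    then show ?thesis using run_in_path_steps t by blast
  next
    case False
    then obtain l where l: "m = Suc l" "t = m" using t run by (cases m) (auto simp: run_def)
    have l': "(nxt ^^ l) s \<in> path_steps s" "(nxt ^^ l) s \<in> retraced"
      using run_in_path_steps run_retraced l by auto
    note R = retraced_turn[OF l'(2)]
    \<comment> \<open>No step of the run starts at its last vertex; the reverse traversal of its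
      last step does.\<close>
    have "u (turn ((nxt ^^ l) s)) = v" using u_turn[OF R(1)] t l by simp
    moreover have "(u ((nxt ^^ l) s), v) \<in> bridge_adj" using l' t l by (auto simp: bridge_adj_def)
    ultimately have "turn ((nxt ^^ l) s) \<in> path_steps s"
      using l'(1) R(2) unfolding path_steps_def by (auto intro: rtrancl.rtrancl_into_rtrancl)
    then show ?thesis using \<open>u (turn ((nxt ^^ l) s)) = v\<close> by blast
  qed
qed

lemma edges_run: "x ` path_steps s = (\<lambda>t. x ((nxt ^^ t) s)) ` {..<m}"
proof (intro equalityI subsetI)
  fix e assume "e \<in> x ` path_steps s"
  then obtain p where p: "p \<in> path_steps s" "e = x p" by blast
  then have "u p \<in> (\<lambda>t. u ((nxt ^^ t) s)) ` {..m}" using verts_run by blast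
  then obtain t where t: "t \<le> m" "u p = u ((nxt ^^ t) s)" by auto
  have "p \<in> retraced" using p by (simp add: path_steps_def)
  from run_retraced_at[OF t(1) this t(2)] show "e \<in> (\<lambda>t. x ((nxt ^^ t) s)) ` {..<m}"
  proof (elim disjE exE conjE)
    fix t' assume t': "t = Suc t'" "p = turn ((nxt ^^ t') s)"
    then have "t' < m" "e = x ((nxt ^^ t') s)"
      using t p retraced_turn(4)[OF run_retraced[of t']] by auto
    then show ?thesis by blast
  qed (use p in blast)
qed (use run_in_path_steps in blast)

lemma subgraph_path: "subgraph (steps_graph (path_steps s)) T"
proof (rule subgraph_TI[where S = "path_steps s"])
  show "path_steps s \<subseteq> {..<n}" using retraced_turn(1) by (auto simp: path_steps_def)
  then show "verts (steps_graph (path_steps s)) \<subseteq> u ` {..<n}" by auto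
  fix q assume q: "q \<in> path_steps s"
  then have "(u q, u (nxt q)) \<in> bridge_adj" by (auto simp: path_steps_def bridge_adj_def)
  then have "(u s, u (turn q)) \<in> bridge_adj\<^sup>*"
    using q u_turn[of q] retraced_turn(1)[of q]
    by (auto simp: path_steps_def intro: rtrancl.rtrancl_into_rtrancl)
  then have "turn q \<in> path_steps s" using q retraced_turn(2) by (simp add: path_steps_def)
  then show "u (nxt q) \<in> verts (steps_graph (path_steps s))"
    using u_turn[of q, symmetric] retraced_turn(1)[of q] q by (simp add: path_steps_def)
qed simp_all

lemma simple_path_run: "simple_path (steps_graph (path_steps s)) (u s) (u ((nxt ^^ m) s))"
proof -
  let ?P = "steps_graph (path_steps s)"
  define Y where "Y = \<lparr>len = m, vtx = \<lambda>t. u ((nxt ^^ t) s),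
    edg = \<lambda>t. x ((nxt ^^ (t - 1)) s), exit_end = \<lambda>t. b ((nxt ^^ (t - 1)) s)\<rparr>"
  have "is_walk ?P Y"
    unfolding is_walk_def
  proof (intro conjI ballI)
    have "0 < m" using run by (simp add: run_def)
    then show "vtx Y 0 \<in> verts ?P" using run_in_path_steps[of 0] by (simp add: Y_def)
    fix i assume "i \<in> {1..len Y}"
    then obtain t where t: "i = Suc t" "t < m" by (cases i) (auto simp: Y_def)
    then show "edg Y i \<in> edges ?P" "ends ?P (edg Y i) (exit_end Y i) = vtx Y (i - 1)"
      "ends ?P (edg Y i) (\<not> exit_end Y i) = vtx Y i"
      using step[OF run_less[of t]] run_in_path_steps by (auto simp: Y_def)
  qed
  moreover have "walk_graph ?P Y = ?P"
  proof -
    have "edg Y ` {1..len Y} = x ` path_steps s"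
      unfolding edges_run image_Suc_lessThan[symmetric] by (simp add: Y_def image_image)
    moreover have "vtx Y ` {0..len Y} = u ` path_steps s"
      unfolding verts_run by (simp add: Y_def atLeast0AtMost)
    ultimately show ?thesis by (simp add: walk_graph_def steps_graph_def)
  qed
  moreover have "inj_on (vtx Y) {0..len Y}" using inj_on_run by (simp add: Y_def atLeast0AtMost)
  ultimately show ?thesis
    using subgraph_path unfolding simple_path_def subgraph_def
    by (intro conjI exI[of _ Y]) (auto simp: Y_def)
qed

text \<open>The run starts in \<open>side s\<close> and could leave it only at
  \<open>twin s\<close>, which it never reaches. So the orbit at its end is confined to
  \<open>side s\<close>, while \<open>twin s\<close> is outside.\<close>

lemma run_ends_differ: "orbit turn (twin s) \<noteq> orbit turn ((nxt ^^ m) s)"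
proof -
  have d: "twin s \<noteq> s" using run_double[of 0] by simp
  have "(nxt ^^ t) s \<in> side s" if "t \<le> m" for t
    using that
  proof (induction t)
    case 0
    then show ?case using side_self run_start d by simp
  next
    case (Suc t)
    then show ?case
      using side_nxt[OF run_start(1) d, of "(nxt ^^ t) s"] run_not_twin[of 0 "Suc t"] by auto
  qed
  then have "orbit turn ((nxt ^^ m) s) \<subseteq> side s"
    using orbit_in_side[OF run_start(1) d] by blast
  then show ?thesis using side_self[OF run_start(1) d] orbit_self[of "twin s"] by auto
qed

text \<open>The position \<open>s\<close> is retraced, so the cycle at the start is the orbit of the
  other visit \<open>twin s\<close>; at the far end the position reached after the run is itself not
  retraced. Inner vertices have both visits retraced and thus meet no cycle.\<close>

lemma run_meets_cycles:
  defines "P \<equiv> steps_graph (path_steps s)"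
  defines "C \<equiv> blk (twin s)" and "C' \<equiv> blk ((nxt ^^ m) s)"
  shows "C \<noteq> C'"
    and "{D \<in> blk ` ({..<n} - retraced). verts D \<inter> verts P \<noteq> {}} = {C, C'}"
    and "verts C \<inter> verts P = {u s}" and "verts C' \<inter> verts P = {u ((nxt ^^ m) s)}"
proof -
  let ?e = "(nxt ^^ m) s"
  have tw: "twin s < n" "u (twin s) = u s" using twin_cases[OF run_start(1)] by auto
  show ne: "C \<noteq> C'"
    unfolding C_def C'_def using blk_eq_iff[OF tw(1) run_less] run_ends_differ by simp
  have P: "verts P = (\<lambda>t. u ((nxt ^^ t) s)) ` {..m}" using verts_run by (simp add: P_def)
  have meet: "p = ?e \<and> v = u ?e \<or> p = twin s \<and> v = u s"
    if "p < n" "p \<notin> retraced" "v = u p" "v \<in> verts P" for p v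
    using that run_not_retraced_at[of _ p] P by fastforce
  have sP: "u s \<in> verts P" "u ?e \<in> verts P"
    unfolding P by (auto intro: image_eqI[of _ _ 0])
  have sC: "u s \<in> verts C" "u ?e \<in> verts C'"
    using orbit_self tw(2) by (auto simp: C_def C'_def intro: image_eqI[of _ _ "twin s"])
  have orb: "?e \<notin> orbit turn (twin s)" "twin s \<notin> orbit turn ?e"
    using run_ends_differ orbit_eq by metis+
  have notR: "q < n \<and> q \<notin> retraced" if "q \<in> orbit turn p" "p < n" "p \<notin> retraced" for p q
    using that inj_on_x_orbit(1)[OF that(2,3)] orbit_less by blast
  show "verts C \<inter> verts P = {u s}"
  proof (intro equalityI subsetI)
    fix v assume v: "v \<in> verts C \<inter> verts P"
    then obtain q where q: "q \<in> orbit turn (twin s)" "v = u q" by (auto simp: C_def)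
    then show "v \<in> {u s}"
      using meet[of q v] notR[OF q(1) tw(1) run_start(2)] v orb by auto
  qed (use sC sP in auto)
  show "verts C' \<inter> verts P = {u ?e}"
  proof (intro equalityI subsetI)
    fix v assume v: "v \<in> verts C' \<inter> verts P"
    then obtain q where q: "q \<in> orbit turn ?e" "v = u q" by (auto simp: C'_def)
    then show "v \<in> {u ?e}"
      using meet[of q v] notR[OF q(1) run_less run_end] v orb by auto
  qed (use sC sP in auto)
  show "{D \<in> blk ` ({..<n} - retraced). verts D \<inter> verts P \<noteq> {}} = {C, C'}"
  proof (intro equalityI subsetI)
    fix D assume "D \<in> {D \<in> blk ` ({..<n} - retraced). verts D \<inter> verts P \<noteq> {}}"
    then obtain p where p: "p < n" "p \<notin> retraced" "D = blk p" "verts D \<inter> verts P \<noteq> {}" by blast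
    then obtain q where "q \<in> orbit turn p" "u q \<in> verts P" by auto
    note pq = p(1-3) this
    then have "q = ?e \<or> q = twin s" using meet[of q "u q"] notR[OF pq(4,1,2)] by auto
    then show "D \<in> {C, C'}" using orbit_eq[OF pq(4)] pq(3) by (auto simp: C_def C'_def)
  next
    fix D assume "D \<in> {C, C'}"
    moreover have "C \<in> blk ` ({..<n} - retraced)" "C' \<in> blk ` ({..<n} - retraced)"
      using tw run_start run_less[of m] run_end by (auto simp: C_def C'_def)
    moreover have "verts C \<inter> verts P \<noteq> {}" "verts C' \<inter> verts P \<noteq> {}" using sC sP by blast+
    ultimately show "D \<in> {D \<in> blk ` ({..<n} - retraced). verts D \<inter> verts P \<noteq> {}}" by blast
  qed
qed

end


section \<open>The cycle-tree\<close>

abbreviation cycles where "cycles \<equiv> blk ` ({..<n} - retraced)"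

text \<open>Steps of one component yield the same graph, so the image has one member per component.
  Each member has an edge; where two cycles meet directly, the vertex is an intersection vertex on
  account of the cycles alone.\<close>

abbreviation paths where "paths \<equiv> (\<lambda>p. steps_graph (path_steps p)) ` retraced"

lemma path_run:
  assumes "P \<in> paths"
  obtains s m where "run s m" "P = steps_graph (path_steps s)"
proof -
  obtain p where p: "p \<in> retraced" "P = steps_graph (path_steps p)" using assms by auto
  obtain s m where "run s m" "path_steps s = path_steps p" by (rule run_reaching[OF p(1)])
  then show ?thesis using that p(2) by simp
qed

lemma path_steps_self: "p \<in> retraced \<Longrightarrow> p \<in> path_steps p"
  by (simp add: path_steps_def)

lemma subgraph_part:
  assumes "B \<in> cycles \<union> paths"
  shows "subgraph B T"
  using assms
proof
  assume "B \<in> paths"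
  then obtain s m where "run s m" "B = steps_graph (path_steps s)" by (rule path_run)
  then show ?thesis using subgraph_path by simp
qed (auto simp: subgraph_blk)

lemma step_covered:
  assumes "p < n"
  shows "\<exists>B\<in>cycles \<union> paths. u p \<in> verts B \<and> x p \<in> edges B"
proof (cases "p \<in> retraced")
  case True
  then show ?thesis
    using path_steps_self by (intro bexI[of _ "steps_graph (path_steps p)"]) auto
next
  case False
  then show ?thesis using assms orbit_self by (intro bexI[of _ "blk p"]) auto
qed

lemma verts_T_parts: "verts T = (\<Union>B\<in>cycles \<union> paths. verts B)"
proof (intro equalityI subsetI)
  fix v assume "v \<in> verts T"
  then show "v \<in> (\<Union>B\<in>cycles \<union> paths. verts B)" using step_covered by (force simp: verts_T)
next
  fix v assume "v \<in> (\<Union>B\<in>cycles \<union> paths. verts B)"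
  then obtain B where B: "B \<in> cycles \<union> paths" "v \<in> verts B" by blast
  then show "v \<in> verts T" using subgraph_part[OF B(1)] by (auto simp: subgraph_def)
qed

lemma edges_T_parts: "edges T = (\<Union>B\<in>cycles \<union> paths. edges B)"
proof (intro equalityI subsetI)
  fix e assume "e \<in> edges T"
  then show "e \<in> (\<Union>B\<in>cycles \<union> paths. edges B)" using step_covered by (force simp: edges_T)
next
  fix e assume "e \<in> (\<Union>B\<in>cycles \<union> paths. edges B)"
  then obtain B where B: "B \<in> cycles \<union> paths" "e \<in> edges B" by blast
  then show "e \<in> edges T" using subgraph_part[OF B(1)] by (auto simp: subgraph_def)
qed

lemma paths_disjoint:
  assumes "P \<in> paths" "P' \<in> paths" "P \<noteq> P'"
  shows "verts P \<inter> verts P' = {}"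
proof -
  obtain p p' where p: "P = steps_graph (path_steps p)" "P' = steps_graph (path_steps p')"
    using assms by auto
  then have "path_steps p \<noteq> path_steps p'" using assms(3) by auto
  then have "u q \<noteq> u r" if "q \<in> path_steps p" "r \<in> path_steps p'" for q r
    using path_steps_shared that by blast
  then show ?thesis using p by auto
qed

lemma cycle_edge_not_retraced:
  assumes "C \<in> cycles" "p < n" "x p \<in> edges C"
  shows "p \<notin> retraced" "C = blk p"
proof -
  obtain q where q: "q < n" "q \<notin> retraced" "C = blk q" using assms(1) by auto
  then have p: "p \<in> orbit turn q" using edge_in_blk[OF assms(2) q(1)] assms(3) by blast
  show "p \<notin> retraced" "C = blk p"
    using inj_on_x_orbit(1)[OF q(1,2)] orbit_eq[OF p] p q(3) by auto
qed

lemma path_edge_retraced: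
  assumes "P \<in> paths" "p < n" "x p \<in> edges P"
  shows "p \<in> retraced"
proof -
  obtain q where q: "q \<in> retraced" "x p = x q" using assms by (auto simp: path_steps_def)
  then show ?thesis using assms(2) retraced_turn(1)[OF q(1)] by (cases "p = q") (auto simp: retraced_def)
qed

lemma parts_edge_disjoint:
  assumes B: "B \<in> cycles \<union> paths" "B' \<in> cycles \<union> paths" "B \<noteq> B'"
  shows "edges B \<inter> edges B' = {}"
proof (rule ccontr)
  assume "edges B \<inter> edges B' \<noteq> {}"
  then obtain e where e: "e \<in> edges B" "e \<in> edges B'" by blast
  then have "e \<in> edges T" using B(1) edges_T_parts by blast
  then obtain p where p: "p < n" "e = x p" by (auto simp: edges_T)
  consider "B \<in> cycles" "B' \<in> cycles" | "B \<in> cycles" "B' \<in> paths" | "B \<in> paths" "B' \<in> cycles"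
    | "B \<in> paths" "B' \<in> paths" using B by blast
  then show False
  proof cases
    case 1
    then show ?thesis using cycle_edge_not_retraced(2) p e B(3) by metis
  next
    case 2
    then show ?thesis using cycle_edge_not_retraced(1) path_edge_retraced p e by metis
  next
    case 3
    then show ?thesis using cycle_edge_not_retraced(1) path_edge_retraced p e by metis
  next
    case 4
    have "ends G e True \<in> verts B" "ends G e True \<in> verts B'"
      using subgraph_part[OF B(1)] subgraph_part[OF B(2)] e
      by (auto simp: subgraph_def wf_signed_graph_def)
    then show ?thesis using paths_disjoint[OF 4 B(3)] by blast
  qed
qed

text \<open>A shared vertex is visited once by each orbit. With two shared vertices, the second
  would have its visits on opposite sides of the first, giving a crossing pair of chords.\<close>

lemma cycles_share_at_most_one:
  assumes "C \<in> cycles" "C' \<in> cycles" "C \<noteq> C'"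
  shows "card (verts C \<inter> verts C') \<le> 1"
proof -
  obtain p p' where p: "p < n" "C = blk p" "p' < n" "C' = blk p'" using assms by auto
  have orb: "orbit turn p \<noteq> orbit turn p'" using p assms(3) by auto
  have shared: "\<exists>q\<in>orbit turn p. q < n \<and> v = u q \<and> twin q \<in> orbit turn p' \<and> twin q \<noteq> q"
    if v: "v \<in> verts C \<inter> verts C'" for v
  proof -
    obtain q q' where q: "q \<in> orbit turn p" "v = u q" "q' \<in> orbit turn p'" "v = u q'"
      using v p by auto
    then have "q \<noteq> q'" using orb orbit_eq by metis
    moreover have "q < n" "q' < n" using q p orbit_less by auto
    ultimately show ?thesis using q twin_eqI[of q q'] by auto
  qed
  have "v = w" if vw: "v \<in> verts C \<inter> verts C'" "w \<in> verts C \<inter> verts C'" for v w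
  proof (rule ccontr)
    assume "v \<noteq> w"
    obtain q where q: "q \<in> orbit turn p" "q < n" "v = u q" "twin q \<in> orbit turn p'" "twin q \<noteq> q"
      using shared[OF vw(1)] by blast
    obtain r where r: "r \<in> orbit turn p" "r < n" "w = u r" "twin r \<in> orbit turn p'" "twin r \<noteq> r"
      using shared[OF vw(2)] by blast
    have tq: "twin q < n" "twin (twin q) \<noteq> twin q" using q twin_cases(1) by auto
    have "r \<in> side q"
      using orbit_in_side[OF q(2,5)] side_self[OF q(2,5)] orbit_eq[OF q(1)] r(1) by blast
    moreover have "twin r \<in> side (twin q)"
      using orbit_in_side[OF tq] side_self[OF tq] orbit_eq[OF q(4)] r(4) by blast
    moreover have "r \<noteq> q" "twin r \<noteq> twin q" using \<open>v \<noteq> w\<close> q r by (auto dest: arg_cong[of _ _ twin])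
    ultimately show False
      using sides_disjoint[OF q(2,5)] twin_cases(2)[OF r(2)] by metis
  qed
  moreover have "finite (verts C \<inter> verts C')"
    using p finite_orbit[OF orbit_self] by simp
  ultimately show ?thesis by (simp add: card_le_Suc0_iff_eq)
qed

lemma intersection_double:
  assumes "intersection_vertex cycles paths v"
  shows "\<exists>p<n. v = u p \<and> twin p \<noteq> p"
  using assms unfolding intersection_vertex_def
proof (elim disjE bexE exE conjE)
  fix C C' assume C: "C \<in> cycles" "C' \<in> cycles" "C \<noteq> C'" "v \<in> verts C \<inter> verts C'"
  then obtain p p' where p: "p < n" "C = blk p" "p' < n" "C' = blk p'" by auto
  then obtain q q' where q: "q \<in> orbit turn p" "v = u q" "q' \<in> orbit turn p'" "v = u q'"
    using C by auto
  have "q \<noteq> q'" using p q C(3) orbit_eq by metis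
  moreover have "q < n" "q' < n" using q p orbit_less by auto
  ultimately show ?thesis using q twin_eqI[of q q'] by auto
next
  fix P w assume "P \<in> paths" "simple_path P v w"
  then obtain q where "q \<in> retraced" "v = u q"
    using simple_path_end_vert by (force simp: path_steps_def)
  then show ?thesis using retraced_turn(1,8) by blast
qed

lemma intersection_vertex_iff:
  assumes "p < n" "p \<notin> retraced"
  shows "intersection_vertex cycles paths (u p) \<longleftrightarrow> twin p \<noteq> p"
proof
  assume "intersection_vertex cycles paths (u p)"
  then obtain q where q: "q < n" "u p = u q" "twin q \<noteq> q" using intersection_double by blast
  then show "twin p \<noteq> p" using twin_cases(3)[OF q(1) assms(1)] twin_twin[OF q(1)] by metis
next
  assume d: "twin p \<noteq> p"
  have tw: "twin p < n" "u (twin p) = u p" "twin (twin p) = p" using twin_cases assms(1) by auto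
  show "intersection_vertex cycles paths (u p)"
  proof (cases "twin p \<in> retraced")
    case False
    have "blk p \<noteq> blk (twin p)"
      using blk_eq_iff[OF assms(1) tw(1)] twin_not_in_orbit[OF assms(1) d] orbit_self[of "twin p"]
      by auto
    moreover have "u p \<in> verts (blk p)" using orbit_self by simp
    moreover have "u p \<in> verts (blk (twin p))"
      using orbit_self[of "twin p"] tw(2) by (metis imageI steps_graph_sel(1))
    moreover have "blk p \<in> cycles" "blk (twin p) \<in> cycles" using assms tw False by auto
    ultimately show ?thesis unfolding intersection_vertex_def by blast
  next
    case True
    \<comment> \<open>The step arriving at \<open>twin p\<close> turns into \<open>p\<close>, hence
      is not retraced, so a run begins exactly at \<open>twin p\<close> and makes \<open>u p\<close>
      an end of a block path.\<close>
    obtain z where z: "z < n" "nxt z = twin p" using nxt_surj tw by blast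
    then have "turn z = p" using tw by (simp add: turn_def)
    then have "z \<notin> retraced" using assms(2) turn_retraced_iff by metis
    then obtain m where "run (twin p) m" using run_from z True by metis
    from simple_path_run[OF this] show ?thesis
      unfolding intersection_vertex_def tw(2) using True by blast
  qed
qed

lemma cycle_tree_T: "cycle_tree T cycles paths"
  unfolding cycle_tree_def
proof (intro conjI ballI allI impI)
  show "cycles = {C. subgraph C T \<and> is_cycle C}" by (simp add: cycles_T)
next
  fix P assume P: "P \<in> paths"
  obtain s m where s: "run s m" "P = steps_graph (path_steps s)" by (rule path_run[OF P])
  show "subgraph P T" using subgraph_path[OF s(1)] s(2) by simp
  show "\<exists>a b. simple_path P a b" using simple_path_run[OF s(1)] s(2) by blast
  show "\<exists>a b C C'. simple_path P a b \<and> C \<noteq> C' \<and> {D \<in> cycles. verts D \<inter> verts P \<noteq> {}} = {C, C'} \<and>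
      verts C \<inter> verts P = {a} \<and> verts C' \<inter> verts P = {b}"
    using simple_path_run[OF s(1)] run_meets_cycles[OF s(1)] s(2) by blast
next
  fix v assume "intersection_vertex cycles paths v"
  then show "cut_point T v" using intersection_double cut_point_iff_double by blast
qed (fact wf_T connected_T verts_T_parts edges_T_parts
    | (rule parts_edge_disjoint paths_disjoint cycles_share_at_most_one; assumption))+

text \<open>Consecutive steps of a block carry equal values of \<open>out\<close> across a single vertex and opposite
  ones across a double vertex, so the signs multiply to \<open>-1\<close> per double vertex.\<close>

lemma prod_sign_orbit:
  assumes "p < n"
  shows "(\<Prod>q\<in>orbit turn p. signed_graph.sign G (x q)) = (-1) ^ card {q \<in> orbit turn p. twin q \<noteq> q}"
proof -
  let ?O = "orbit turn p"
  define f :: "nat \<Rightarrow> int" where "f q = (if twin q \<noteq> q then -1 else 1)" for q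
  have fin: "finite ?O" using finite_orbit[OF orbit_self] .
  have lt: "q < n" if "q \<in> ?O" for q using orbit_less[OF assms that] .
  have inj: "inj_on turn ?O" by (rule inj_on_subset[OF permutes_inj[OF turn_permutes]]) simp
  have "turn ` ?O = ?O" by (rule endo_inj_surj[OF fin _ inj]) (auto intro: orbit.step)
  then have "bij_betw turn ?O ?O" using inj by (simp add: bij_betw_def)
  then have shift: "(\<Prod>q\<in>?O. g (turn q)) = (\<Prod>q\<in>?O. g q)" for g :: "nat \<Rightarrow> int"
    by (rule prod.reindex_bij_betw)
  have "signed_graph.sign G (x q) = out q * (f (turn q) * out (turn q))" if q: "q \<in> ?O" for q
  proof -
    have r: "nxt q < n" "turn q = twin (nxt q)" using lt[OF q] by (auto simp: turn_def)
    have "out (nxt q) = f (turn q) * out (turn q)"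
      using out_twin[OF r(1)] r twin_twin[OF r(1)] by (simp add: f_def)
    then show ?thesis using eps_step(3)[OF lt[OF q]] by simp
  qed
  then have "(\<Prod>q\<in>?O. signed_graph.sign G (x q)) = (\<Prod>q\<in>?O. out q * (f (turn q) * out (turn q)))"
    by (rule prod.cong[OF refl])
  \<comment> \<open>Reindexing the factors by the permutation \<open>turn\<close> of the orbit
    brings the two values of \<open>out\<close> at each position together, and their product is
    1.\<close>
  also have "\<dots> = (\<Prod>q\<in>?O. out q * (f q * out q))"
    unfolding prod.distrib using shift[of f] shift[of out] by simp
  also have "\<dots> = (\<Prod>q\<in>?O. f q)"
  proof (rule prod.cong[OF refl])
    fix q assume "q \<in> ?O"
    then show "out q * (f q * out q) = f q" using eps_step(1)[OF lt[of q]] by auto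
  qed
  also have "\<dots> = (\<Prod>q\<in>{q \<in> ?O. twin q \<noteq> q}. -1)"
    unfolding f_def by (rule prod.inter_filter[OF fin, symmetric])
  finally show ?thesis by simp
qed

text \<open>On the orbit of a cycle both \<open>x\<close> and \<open>u\<close> are injective, so the
  product over edges is the product over steps, and intersection vertices correspond to the
  positions at double vertices that the sign formula counts.\<close>

lemma balanced_cycle_iff:
  assumes "C \<in> cycles"
  shows "balanced C \<longleftrightarrow> even (card {v \<in> verts C. intersection_vertex cycles paths v})"
proof -
  obtain p where p: "p < n" "p \<notin> retraced" "C = blk p" using assms by auto
  have int: "intersection_vertex cycles paths (u q) \<longleftrightarrow> twin q \<noteq> q" if "q \<in> orbit turn p" for q
    using intersection_vertex_iff[of q] inj_on_x_orbit(1)[OF p(1,2)] orbit_less[OF p(1)] that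
    by blast
  then have "{v \<in> verts C. intersection_vertex cycles paths v} = u ` {q \<in> orbit turn p. twin q \<noteq> q}"
    by (auto simp: p(3))
  moreover have "inj_on u {q \<in> orbit turn p. twin q \<noteq> q}"
    by (rule inj_on_subset[OF inj_on_orbit[OF p(1)]]) auto
  ultimately have card: "card {v \<in> verts C. intersection_vertex cycles paths v} =
      card {q \<in> orbit turn p. twin q \<noteq> q}"
    by (simp add: card_image)
  have "(\<Prod>e\<in>edges C. signed_graph.sign C e) = (\<Prod>q\<in>orbit turn p. signed_graph.sign G (x q))"
    using prod.reindex[OF inj_on_x_orbit(2)[OF p(1,2)]] by (simp add: p(3))
  then show ?thesis
    unfolding balanced_def card prod_sign_orbit[OF p(1)] by (simp add: minus_one_power_iff)
qed

lemma direction_T: "cycle_tree_direction T cycles eps"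
  unfolding cycle_tree_direction_def
proof (intro conjI ballI impI)
  show "orientation T eps"
    unfolding orientation_def
  proof (intro ballI)
    fix e assume "e \<in> edges T"
    then obtain p where p: "p < n" "e = x p" by (auto simp: edges_T)
    have "out p \<in> {1, -1}" "out (nxt p) \<in> {1, -1}" using eps_step(1) p by auto
    then show "(\<forall>c. eps e c \<in> {1, -1}) \<and> eps e True * eps e False = - signed_graph.sign T e"
      using eps_step(2,3)[OF p(1)] p(2) by (cases "b p") (auto simp: all_bool_eq)
  qed
next
  fix v assume "v \<in> verts T"
  then obtain p where p: "p < n" "v = u p" by (auto simp: verts_T)
  \<comment> \<open>Arrival and departure at any single visit have opposite values, which excludes
    both a sink and a source.\<close>
  obtain q where q: "q < n" "nxt q = p" using nxt_surj p by blast
  have "x p \<in> edges T" "x q \<in> edges T" using p q by (auto simp: edges_T)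
  moreover have "ends T (x p) (b p) = v" "ends T (x q) (\<not> b q) = v" using step p q by auto
  moreover have "eps (x q) (\<not> b q) = - eps (x p) (b p)" using eps_step(2)[OF q(1)] q by simp
  ultimately show "\<not> sink T eps v" "\<not> source T eps v"
    unfolding sink_def source_def by force+
next
  fix C v assume C: "C \<in> cycles" "v \<in> verts C" "cut_point T v"
  then obtain p where p: "p < n" "C = blk p" by auto
  then obtain q where q: "q \<in> orbit turn p" "v = u q" using C by auto
  have "q < n" using orbit_less p q by blast
  then have d: "twin q \<noteq> q" using cut_point_iff_double C(3) q by simp
  \<comment> \<open>The block arrives at the double vertex by a step whose successor in the walk is
    \<open>twin q\<close>; its value there is \<open>- out (twin q)\<close>, which equals the
    departure value \<open>out q\<close>.\<close>
  have "eps e c = out q" if e: "e \<in> edges C" "ends C e c = v" for e c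
  proof -
    consider "(e, c) = (x q, b q)" | r where "r \<in> orbit turn p" "turn r = q" "(e, c) = (x r, \<not> b r)"
      using edge_end_in_blk[OF p(1) q(1), of e c] e p q by auto
    then show ?thesis
    proof cases
      case 2
      then have r: "r < n" using orbit_less p by blast
      then have "nxt r = twin q" using 2(2) twin_twin[of "nxt r"] by (simp add: turn_def)
      then show ?thesis using eps_step(2)[OF r] out_twin[OF \<open>q < n\<close> d] 2(3) by simp
    qed simp
  qed
  then show "sink C eps v \<or> source C eps v"
    using eps_step(1)[OF \<open>q < n\<close>] C(2) unfolding sink_def source_def by auto
qed

section \<open>Edge multiplicities and crossing at cut-points\<close>

lemma uses_eq: "uses W e = card {p. p < n \<and> x p = e}"
proof -
  have "{i \<in> {1..n}. edg W i = e} = Suc ` {p. p < n \<and> x p = e}"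
  proof (intro equalityI subsetI)
    fix i assume "i \<in> {i \<in> {1..n}. edg W i = e}"
    then show "i \<in> Suc ` {p. p < n \<and> x p = e}"
      by (intro image_eqI[of _ _ "i - 1"]) (auto simp: x_def)
  qed (auto simp: x_def)
  then show ?thesis by (simp add: uses_def card_image)
qed

lemma uses_cycle_edge:
  assumes "C \<in> cycles" "e \<in> edges C"
  shows "uses W e = 1"
proof -
  have "e \<in> edges T" using edges_T_parts assms by blast
  then obtain p where p: "p < n" "e = x p" by (auto simp: edges_T)
  then have "p \<notin> retraced" using cycle_edge_not_retraced(1)[OF assms(1)] assms(2) by blast
  then have "{q. q < n \<and> x q = e} = {p}" using p by (auto simp: retraced_def)
  then show ?thesis by (simp add: uses_eq)
qed

lemma uses_path_edge:
  assumes "P \<in> paths" "e \<in> edges P"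
  shows "uses W e = 2"
proof -
  have "e \<in> edges T" using edges_T_parts assms by blast
  then obtain p where p: "p < n" "e = x p" by (auto simp: edges_T)
  then have "p \<in> retraced" using path_edge_retraced[OF assms(1)] assms(2) by blast
  note R = retraced_turn[OF this]
  have "{q. q < n \<and> x q = e} = {p, turn p}"
    using R(1,4) p repeated_edge(1)[of p] by auto
  then show ?thesis using R(3) by (simp add: uses_eq card_insert_if)
qed

text \<open>Both visits of the vertex, \<open>nxt p\<close> and \<open>turn p\<close>, are retraced,
  so no cycle passes there. As an end of a path it would have only one path edge, which would make
  \<open>nxt p\<close> equal to \<open>p\<close>, a loop at a double vertex.\<close>

lemma not_intersection_inside_path:
  assumes "p \<in> retraced" "nxt p \<in> retraced"
  shows "\<not> intersection_vertex cycles paths (u (nxt p))"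
proof
  let ?q = "nxt p"
  note R = retraced_turn[OF assms(1)] and R' = retraced_turn[OF assms(2)]
  have tw: "twin ?q = turn p" "twin ?q \<noteq> ?q" using retraced_nxt_double[OF assms(1)] by auto
  assume "intersection_vertex cycles paths (u ?q)"
  then show False
    unfolding intersection_vertex_def
  proof (elim disjE bexE exE conjE)
    fix C C' assume C: "C \<in> cycles" "u ?q \<in> verts C \<inter> verts C'"
    then obtain a where a: "a < n" "a \<notin> retraced" "C = blk a" by auto
    then obtain r where r: "r \<in> orbit turn a" "u r = u ?q" using C by auto
    have "r < n" "r \<notin> retraced"
      using r a orbit_less inj_on_x_orbit(1)[OF a(1,2)] by auto
    then show False using twin_cases(3)[OF R'(1) \<open>r < n\<close> r(2)] tw R(2) assms(2) by auto
  next
    fix P w assume P: "P \<in> paths" "simple_path P (u ?q) w"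
    then obtain a where a: "P = steps_graph (path_steps a)" by auto
    then obtain r where "r \<in> path_steps a" "u r = u ?q"
      using simple_path_end_vert[OF P(2)] by auto
    then have "?q \<in> path_steps a" "turn p \<in> path_steps a"
      using assms(2) R(2) u_turn[OF R(1)] by (auto simp: path_steps_def)
    then have "x ?q = x (turn p)"
      using a step(2)[OF R'(1)] step(2)[of "turn p"] R(1) u_turn[OF R(1)]
      by (intro simple_path_end_unique_edge[OF P(2), of _ _ "b ?q" "b (turn p)"]) auto
    then have "?q = turn (turn p)"
      using repeated_edge(1)[of "turn p" ?q] tw R(1) by auto
    then show False using no_loop[OF R(1,8)] R(6) by simp
  qed
qed

text \<open>Step \<open>p\<close> shares its block with \<open>turn p\<close>, which starts from the
  twin of \<open>nxt p\<close>; the walk instead continues with \<open>nxt p\<close>, whose orbit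
  avoids that twin. As a vertex has only two visits, these are all the blocks there.\<close>

lemma crosses_T: "crosses_at_cut_points T cycles paths W"
  unfolding crosses_at_cut_points_def
proof (intro ballI impI)
  fix i assume i: "i \<in> {1..n}" and cut: "cut_point T (u i)"
  then obtain p where p: "i = Suc p" "p < n" by (cases i) auto
  let ?q = "nxt p"
  have v: "u i = u ?q" using u_nxt p by simp
  have e: "edg W i = x p" "next_edg W i = x ?q"
    using p by (auto simp: x_def next_edg_def nxt_eq)
  have d: "twin ?q \<noteq> ?q" using cut cut_point_iff_double[of ?q] v by simp
  have "orbit turn p = orbit turn (twin ?q)" using orbit_turn[of p] p by (simp add: turn_def)
  then have orb: "blk p = blk (twin ?q)" "blk p \<noteq> blk ?q"
    using blk_eq_iff[OF p(2), of ?q] twin_not_in_orbit[OF _ d] orbit_self[of "twin ?q"] by auto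
  have mem: "x p \<in> edges (blk p)" "x ?q \<in> edges (blk ?q)" using orbit_self by auto
  show "(\<exists>B B'. B \<noteq> B' \<and> {D. block T D \<and> u i \<in> verts D} = {B, B'} \<and>
           edg W i \<in> edges B \<and> next_edg W i \<in> edges B') \<and>
        (intersection_vertex cycles paths (u i) \<longrightarrow>
           (\<exists>B\<in>cycles \<union> paths. \<exists>B'\<in>cycles \<union> paths. B \<noteq> B' \<and> edg W i \<in> edges B \<and> next_edg W i \<in> edges B'))"
  proof (intro conjI impI)
    have "{D. block T D \<and> u i \<in> verts D} = {blk p, blk ?q}"
    proof (intro equalityI subsetI)
      fix D assume "D \<in> {D. block T D \<and> u i \<in> verts D}"
      then obtain r where r: "r < n" "D = blk r" "u ?q \<in> verts D" by (auto simp: block_iff v)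
      then obtain r' where r': "r' \<in> orbit turn r" "u r' = u ?q" by auto
      then have "r' = ?q \<or> r' = twin ?q" using twin_cases(3)[of ?q r'] orbit_less[OF r(1)] by auto
      then show "D \<in> {blk p, blk ?q}" using orb(1) r(2) orbit_eq[OF r'(1)] by auto
    next
      fix D assume "D \<in> {blk p, blk ?q}"
      moreover have "u ?q \<in> verts (blk ?q)" using orbit_self by simp
      moreover have "u ?q \<in> verts (blk p)"
        using orbit.base[of turn p] u_turn[OF p(2)] by (metis imageI steps_graph_sel(1))
      moreover have "block T (blk p)" "block T (blk ?q)" using p(2) nxt_less[of p] unfolding block_iff by blast+
      ultimately show "D \<in> {D. block T D \<and> u i \<in> verts D}" unfolding v by blast
    qed
    then show "\<exists>B B'. B \<noteq> B' \<and> {D. block T D \<and> u i \<in> verts D} = {B, B'} \<and>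
           edg W i \<in> edges B \<and> next_edg W i \<in> edges B'"
      using orb(2) mem unfolding e by (intro exI conjI)
  next
    assume int: "intersection_vertex cycles paths (u i)"
    obtain B where B: "B \<in> cycles \<union> paths" "x p \<in> edges B" using step_covered[OF p(2)] by blast
    obtain B' where B': "B' \<in> cycles \<union> paths" "x ?q \<in> edges B'" using step_covered[of ?q] by auto
    have "B \<noteq> B'"
    proof
      assume "B = B'"
      \<comment> \<open>Staying in one cycle means staying in one block; staying in one path makes
        both steps retraced, which happens only at inner vertices of the path.\<close>
      then consider "B \<in> cycles" | "p \<in> retraced" "?q \<in> retraced"
        using B B' path_edge_retraced p(2) nxt_less by blast
      then show False
      proof cases
        case 1
        then have "blk p = blk ?q"
          using cycle_edge_not_retraced(2) B(2) B'(2) \<open>B = B'\<close> p(2) nxt_less by metis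
        then show ?thesis using orb(2) by simp
      next
        case 2
        then show ?thesis using not_intersection_inside_path int v by simp
      qed
    qed
    then show "\<exists>B\<in>cycles \<union> paths. \<exists>B'\<in>cycles \<union> paths. B \<noteq> B' \<and> edg W i \<in> edges B \<and> next_edg W i \<in> edges B'"
      using B B' unfolding e by (intro bexI conjI)
  qed
qed

end

theorem theorem2p5:
  fixes \<Sigma> :: "('v, 'e) signed_graph"
    and W :: "('v, 'e) walk"
    and eps :: "'e \<Rightarrow> bool \<Rightarrow> int"
  assumes "wf_signed_graph \<Sigma>"
    and "directed_closed_walk \<Sigma> W eps"
    and "midway_back_avoided W eps"
    and "\<And>v. double_vertex W v \<Longrightarrow> cut_point (walk_graph \<Sigma> W) v"
  shows "\<exists>\<C> \<P>.
      eulerian_cycle_tree (walk_graph \<Sigma> W) \<C> \<P> \<and>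
      cycle_tree_direction (walk_graph \<Sigma> W) \<C> eps \<and>
      (\<forall>C\<in>\<C>. \<forall>e\<in>edges C. uses W e = 1) \<and>
      (\<forall>P\<in>\<P>. \<forall>e\<in>edges P. uses W e = 2) \<and>
      crosses_at_cut_points (walk_graph \<Sigma> W) \<C> \<P> W"
proof -
  interpret tame_walk \<Sigma> W eps
    using assms by unfold_locales
  have "eulerian_cycle_tree T cycles paths"
    unfolding eulerian_cycle_tree_def using cycle_tree_T balanced_cycle_iff by blast
  then show ?thesis
    using direction_T uses_cycle_edge uses_path_edge crosses_T by blast
qed

end
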